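(* Let $d\ge2$, $\epsilon>0$ and $0<\beta<1/2$. With probability tending to $1$ over $G\sim\mathcal G_d(N,1/2,N^\beta)$, the following holds: for every $\lambda>1$ there exists an initial state from which the expected time for the Metropolis process on $G$ with parameter $\lambda$ to reach a clique of size at least $m$ exceeds $N^{\Omega((\log_2N)^{1/(d-1)})}$, where $$m=2\Big\lceil\Big(\big(1+\tfrac23\epsilon\big)\tfrac{d!}{2}\log_2N\Big)^{\frac1{d-1}}\Big\rceil-\Big\lceil\Big(\big(1+\tfrac23\epsilon\big)(d-1)!\log_2N\Big)^{\frac1{d-1}}\Big\rceil.$$
   Context: $\mathcal G_d(N,1/2,\kappa)$: random $d$-uniform hypergraph on $[N]$ with each $d$-subset a hyperedge independently with probability $1/2$, plus all $d$-subsets of a uniformly random $\kappa$-subset (the planted clique). A clique is a vertex subset all of whose $d$-subsets are hyperedges (including the empty set and sets of size $<d$). The Metropolis process with parameter $\lambda\ge1$ is the Markov chain on the set of cliques of $G$: from the current clique $K$, pick a vertex $v$ uniformly from $[N]$; if $v\notin K$ and $K\cup\{v\}$ is a clique, move to $K\cup\{v\}$; if $v\notin K$ and $K\cup\{v\}$ is not a clique, stay at $K$; if $v\in K$, move to $K\setminus\{v\}$ with probability $1/\lambda$ and otherwise stay at $K$. *)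

theory Defs
  imports "HOL-Probability.Probability"
begin

definition dsets :: "nat \<Rightarrow> nat \<Rightarrow> nat set set" where
  "dsets N d = {S. S \<subseteq> {1..N} \<and> card S = d}"

definition is_clique :: "nat \<Rightarrow> nat \<Rightarrow> nat set set \<Rightarrow> nat set \<Rightarrow> bool" where
  "is_clique N d E K \<longleftrightarrow> K \<subseteq> {1..N} \<and> (\<forall>S. S \<subseteq> K \<and> card S = d \<longrightarrow> S \<in> E)"

text \<open>The planted model G_d(N,1/2,kappa): a uniformly random set of d-subsets
  (each present independently with probability 1/2) together with all d-subsets of
  a uniformly random kappa-subset of [N].\<close>
definition planted_hypergraph :: "nat \<Rightarrow> nat \<Rightarrow> nat \<Rightarrow> nat set set pmf" where
  "planted_hypergraph N d kappa =
     map_pmf (\<lambda>(C, E). E \<union> {S. S \<subseteq> C \<and> card S = d})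
       (pair_pmf (pmf_of_set {C. C \<subseteq> {1..N} \<and> card C = kappa})
                 (pmf_of_set (Pow (dsets N d))))"

text \<open>metro_surv N d E lam m t K = probability that the Metropolis process on the
  hypergraph E with parameter lam, started at K, has not visited a clique of size at
  least m during steps 0..t.\<close>
fun metro_surv :: "nat \<Rightarrow> nat \<Rightarrow> nat set set \<Rightarrow> real \<Rightarrow> int \<Rightarrow> nat \<Rightarrow> nat set \<Rightarrow> real" where
  "metro_surv N d E lam m 0 K = (if m \<le> int (card K) then 0 else 1)"
| "metro_surv N d E lam m (Suc t) K =
     (if m \<le> int (card K) then 0 else
       (\<Sum>v\<in>{1..N}.
          (if v \<notin> K then
             (if is_clique N d E (insert v K)
              then metro_surv N d E lam m t (insert v K)
              else metro_surv N d E lam m t K)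
           else (1 / lam) * metro_surv N d E lam m t (K - {v})
                + (1 - 1 / lam) * metro_surv N d E lam m t K)) / real N)"

text \<open>Expected hitting time of the set of cliques of size at least m:
  E[T] = sum over t of P(T > t).\<close>
definition metro_expected_hit :: "nat \<Rightarrow> nat \<Rightarrow> nat set set \<Rightarrow> real \<Rightarrow> int \<Rightarrow> nat set \<Rightarrow> ennreal" where
  "metro_expected_hit N d E lam m K = (\<Sum>t. ennreal (metro_surv N d E lam m t K))"

definition m_threshold :: "nat \<Rightarrow> nat \<Rightarrow> real \<Rightarrow> int" where
  "m_threshold N d \<epsilon> =
     2 * \<lceil>((1 + 2/3 * \<epsilon>) * (fact d / 2) * log 2 (real N)) powr (1 / (real d - 1))\<rceil>
     - \<lceil>((1 + 2/3 * \<epsilon>) * fact (d - 1) * log 2 (real N)) powr (1 / (real d - 1))\<rceil>"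

end

theory Submission
  imports Defs "HOL-Real_Asymp.Real_Asymp"
begin

text \<open>Following Jerrum's argument for graphs, the barrier sits at the cliques of a size \<open>k\<close> slightly
  above \<open>T = ((d - 1)! log\<^sub>2 N)\<^bsup>1/(d-1)\<^esup>\<close>, where extending a typical clique becomes impossible.
  Call a \<open>k\<close>-clique a gateway if a clique of the target size can be reached from it without
  dropping below size \<open>k\<close>. All \<open>k\<close>-cliques have the same stationary weight \<open>\<lambda>\<^bsup>k\<^esup>\<close>, so the
  stationary flow out of the states behind the gateways is at most the proportion of gateways among the
  \<open>k\<close>-cliques, whatever \<open>\<lambda>\<close> is. A gateway \<open>K\<close> has a partner \<open>k\<close>-clique \<open>K'\<close> with
  \<open>card (K' - K) = b\<close>, where \<open>b\<close> is of order \<open>T\<close>. A first moment bound on such pairs gives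
  \<open>N\<^bsup>-\<Omega>(b)\<^esup>\<close> times the expected number of \<open>k\<close>-cliques, and a second moment bound shows that the
  latter number is attained up to a factor 2. Both moments, as well as the effect of the planted
  clique, reduce to the same estimate for a uniformly random subset \<open>C\<close> (\<open>sum_uniform_subset_le\<close>):
  since \<open>\<beta> < 1/2 \<le> 1 - 1/d\<close>, the hyperedges shared with \<open>C\<close> never compensate for the
  unlikelihood of meeting \<open>C\<close>. The target size exceeds that needed here, so a small
  \<open>\<eta>\<close> replaces \<open>\<epsilon>\<close>.\<close>

section \<open>Escape through the gateways\<close>

definition dfaces :: "nat \<Rightarrow> nat set \<Rightarrow> nat set set" where
  "dfaces d K = {S. S \<subseteq> K \<and> card S = d}"

definition kcliques :: "nat \<Rightarrow> nat \<Rightarrow> nat set set \<Rightarrow> nat \<Rightarrow> nat set set" where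
  "kcliques N d E k = {K. is_clique N d E K \<and> card K = k}"

text \<open>For \<open>b \<le> k\<close>, an intersection of size \<open>k - b\<close> means that
  each clique has exactly \<open>b\<close> vertices outside the other.\<close>

definition clique_pairs :: "nat \<Rightarrow> nat \<Rightarrow> nat set set \<Rightarrow> nat \<Rightarrow> nat \<Rightarrow> (nat set \<times> nat set) set" where
  "clique_pairs N d E k b =
     {(K, K'). K \<in> kcliques N d E k \<and> K' \<in> kcliques N d E k \<and> card (K \<inter> K') = k - b}"

lemma is_clique_iff: "is_clique N d E K \<longleftrightarrow> K \<subseteq> {1..N} \<and> dfaces d K \<subseteq> E"
  by (auto simp: is_clique_def dfaces_def)

lemma is_clique_subset: "is_clique N d E K \<Longrightarrow> K' \<subseteq> K \<Longrightarrow> is_clique N d E K'"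
  unfolding is_clique_iff dfaces_def by blast

lemma is_clique_finite: "is_clique N d E K \<Longrightarrow> finite K"
  unfolding is_clique_def by (meson finite_atLeastAtMost finite_subset)

lemma finite_cliques: "finite {K. is_clique N d E K \<and> P K}"
  by (rule finite_subset[of _ "Pow {1..N}"]) (auto simp: is_clique_def)

section \<open>Loss of stationary mass per step\<close>

lemma metro_surv_bounds:
  assumes "lam > 1" "N \<ge> 1"
  shows "0 \<le> metro_surv N d E lam M t K \<and> metro_surv N d E lam M t K \<le> 1"
proof (induction t arbitrary: K)
  case (Suc t)
  let ?g = "\<lambda>K. metro_surv N d E lam M t K"
  let ?s = "\<lambda>v. (if v \<notin> K then (if is_clique N d E (insert v K) then ?g (insert v K) else ?g K)
           else (1 / lam) * ?g (K - {v}) + (1 - 1 / lam) * ?g K)"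
  have p: "0 \<le> 1 / lam" "0 \<le> 1 - 1 / lam" using assms by auto
  have conv: "0 \<le> (1 / lam) * x + (1 - 1 / lam) * y \<and> (1 / lam) * x + (1 - 1 / lam) * y \<le> 1"
    if "0 \<le> x" "x \<le> 1" "0 \<le> y" "y \<le> 1" for x y :: real
  proof -
    have "(1 / lam) * x \<le> 1 / lam" "(1 - 1 / lam) * y \<le> 1 - 1 / lam"
      using that p mult_left_mono[of x 1 "1 / lam"] mult_left_mono[of y 1 "1 - 1 / lam"] by simp_all
    moreover have "0 \<le> (1 / lam) * x" "0 \<le> (1 - 1 / lam) * y"
      using that p by (intro mult_nonneg_nonneg; simp)+
    ultimately show ?thesis by (metis add_mono add_nonneg_nonneg add_diff_cancel_left' add_diff_eq)
  qed
  have s: "0 \<le> ?s v \<and> ?s v \<le> 1" for v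
    using Suc.IH conv by (cases "v \<in> K") auto
  have "0 \<le> (\<Sum>v\<in>{1..N}. ?s v)" using s by (intro sum_nonneg) blast
  moreover have "(\<Sum>v\<in>{1..N}. ?s v) \<le> (\<Sum>v\<in>{1..N}. 1)" using s by (intro sum_mono) blast
  ultimately have "0 \<le> (\<Sum>v\<in>{1..N}. ?s v) / real N \<and> (\<Sum>v\<in>{1..N}. ?s v) / real N \<le> 1"
    using assms by (auto simp: divide_simps)
  then show ?case unfolding metro_surv.simps by (simp only: split: if_split) auto
qed auto

text \<open>Detailed balance: the weight \<open>lam ^ card K\<close> is reversible for the update of each single vertex
  \<open>v\<close>, so summed over \<open>S\<close> an update can only lose mass through the exits in \<open>G\<close>.\<close>

lemma vertex_update_flow:
  fixes g :: "nat set \<Rightarrow> real"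
  assumes lam: "lam > 1" and finS: "finite S" and finG: "finite G"
    and cl: "\<And>K. K \<in> S \<Longrightarrow> is_clique N d E K"
    and down: "\<And>K v. K \<in> S \<Longrightarrow> K - {v} \<in> S"
    and exit: "\<And>K v. K \<in> S \<Longrightarrow> is_clique N d E (insert v K) \<Longrightarrow> insert v K \<notin> S \<Longrightarrow> insert v K \<in> G"
    and g: "\<And>K. 0 \<le> g K \<and> g K \<le> 1"
  shows "(\<Sum>K\<in>S. lam ^ card K *
           (if v \<notin> K then (if is_clique N d E (insert v K) then g (insert v K) else g K)
            else (1 / lam) * g (K - {v}) + (1 - 1 / lam) * g K))
         \<ge> (\<Sum>K\<in>S. lam ^ card K * g K) - (\<Sum>K\<in>G. lam ^ card K)"
    (is "?L \<ge> _")
proof -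
  \<comment> \<open>The cases for updating \<open>v\<close>: a deletion is proposed
    (\<open>I\<close>), an addition stays in \<open>S\<close> (\<open>J\<close>), an addition leaves
    \<open>S\<close> (\<open>H\<close>), an addition is blocked (\<open>O'\<close>).\<close>
  define I where "I = {K \<in> S. v \<in> K}"
  define J where "J = {K \<in> S. v \<notin> K \<and> insert v K \<in> S}"
  define H where "H = {K \<in> S. v \<notin> K \<and> insert v K \<notin> S \<and> is_clique N d E (insert v K)}"
  define O' where "O' = {K \<in> S. v \<notin> K \<and> \<not> is_clique N d E (insert v K)}"
  define w where "w = (\<lambda>K::nat set. lam ^ card K)"
  have finK: "finite K" if "K \<in> S" for K using cl[OF that] is_clique_finite by blast
  have fin: "finite I" "finite J" "finite H" "finite O'"
    using finS by (auto simp: I_def J_def H_def O'_def)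
  have split: "(\<Sum>K\<in>S. f K) = sum f I + sum f J + sum f H + sum f O'" for f :: "nat set \<Rightarrow> real"
  proof -
    have "S = ((I \<union> J) \<union> H) \<union> O'" using cl by (auto simp: I_def J_def H_def O'_def)
    moreover have "I \<inter> J = {}" "(I \<union> J) \<inter> H = {}" "((I \<union> J) \<union> H) \<inter> O' = {}"
      using cl by (auto simp: I_def J_def H_def O'_def)
    ultimately show ?thesis using fin by (simp add: sum.union_disjoint)
  qed
  have wins: "w (insert v K) = lam * w K" if "K \<in> S" "v \<notin> K" for K
    using that finK by (simp add: w_def)
  have bij: "bij_betw (insert v) J I"
    unfolding bij_betw_def
  proof
    show "inj_on (insert v) J" by (auto simp: J_def inj_on_def)
    have "K \<in> insert v ` J" if "K \<in> I" for K
    proof (rule image_eqI)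
      show "K = insert v (K - {v})" using that by (auto simp: I_def)
      then show "K - {v} \<in> J" using that down by (auto simp: I_def J_def)
    qed
    then show "insert v ` J = I" by (auto simp: I_def J_def)
  qed
  \<comment> \<open>Inserting \<open>v\<close> multiplies the weight by \<open>lam\<close>, which
    the deletion probability \<open>1 / lam\<close> cancels: the flow up from \<open>J\<close>
    balances the flow down from \<open>I\<close>.\<close>
  have J1: "(\<Sum>K\<in>J. w K * g (insert v K)) = (\<Sum>K\<in>I. w K / lam * g K)"
  proof -
    have "(\<Sum>K\<in>I. w K / lam * g K) = (\<Sum>K\<in>J. w (insert v K) / lam * g (insert v K))"
      by (rule sum.reindex_bij_betw[OF bij, symmetric])
    also have "\<dots> = (\<Sum>K\<in>J. w K * g (insert v K))"
      using lam by (intro sum.cong) (auto simp: wins J_def)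
    finally show ?thesis by simp
  qed
  have I1: "(\<Sum>K\<in>I. w K / lam * g (K - {v})) = (\<Sum>K\<in>J. w K * g K)"
  proof -
    have "(\<Sum>K\<in>I. w K / lam * g (K - {v}))
        = (\<Sum>K\<in>J. w (insert v K) / lam * g (insert v K - {v}))"
      by (rule sum.reindex_bij_betw[OF bij, symmetric])
    also have "\<dots> = (\<Sum>K\<in>J. w K * g K)"
      using lam by (intro sum.cong) (auto simp: wins J_def)
    finally show ?thesis .
  qed
  \<comment> \<open>Only the mass of \<open>H\<close> can be lost. It is charged to the cliques
    \<open>insert v K\<close> in \<open>G\<close>, which are distinct and heavier because
    \<open>lam > 1\<close>; what \<open>g\<close> contributes after the exit is merely
    nonnegative.\<close>
  have H1: "(\<Sum>K\<in>H. w K * g K) \<le> (\<Sum>K\<in>G. w K)"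
  proof -
    have inj: "inj_on (insert v) H" by (auto simp: H_def inj_on_def)
    have "(\<Sum>K\<in>H. w K * g K) \<le> (\<Sum>K\<in>H. w (insert v K))"
    proof (rule sum_mono)
      fix K assume K: "K \<in> H"
      have "w K * g K \<le> w K * 1" using g lam by (intro mult_left_mono) (auto simp: w_def)
      also have "\<dots> \<le> lam * w K" using lam by (simp add: w_def)
      also have "\<dots> = w (insert v K)" using K by (subst wins) (auto simp: H_def)
      finally show "w K * g K \<le> w (insert v K)" .
    qed
    also have "\<dots> = (\<Sum>K\<in>insert v ` H. w K)" using inj by (simp add: sum.reindex)
    also have "\<dots> \<le> (\<Sum>K\<in>G. w K)"
      using exit finG lam by (intro sum_mono2) (auto simp: H_def w_def)
    finally show ?thesis .
  qed
  let ?h = "\<lambda>K. w K * (if v \<notin> K then (if is_clique N d E (insert v K) then g (insert v K) else g K)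
            else (1 / lam) * g (K - {v}) + (1 - 1 / lam) * g K)"
  have hI: "sum ?h I = (\<Sum>K\<in>I. w K / lam * g (K - {v})) + ((\<Sum>K\<in>I. w K * g K) - (\<Sum>K\<in>I. w K / lam * g K))"
    unfolding sum_subtractf[symmetric] sum.distrib[symmetric]
    by (intro sum.cong) (auto simp: I_def algebra_simps)
  have hJ: "sum ?h J = (\<Sum>K\<in>J. w K * g (insert v K))"
    using cl by (intro sum.cong) (auto simp: J_def)
  have hH: "sum ?h H \<ge> 0"
    using g lam by (intro sum_nonneg) (auto simp: H_def w_def)
  have hO: "sum ?h O' = (\<Sum>K\<in>O'. w K * g K)"
    by (intro sum.cong) (auto simp: O'_def)
  have "?L = sum ?h S" by (simp add: w_def)
  also have "\<dots> = sum ?h I + sum ?h J + sum ?h H + sum ?h O'" by (rule split)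
  also have "\<dots> \<ge> (\<Sum>K\<in>S. w K * g K) - (\<Sum>K\<in>G. w K)"
    using split[of "\<lambda>K. w K * g K"] hI hJ hH hO I1 J1 H1 by linarith
  finally show ?thesis by (simp add: w_def)
qed

text \<open>The weights act as an unnormalised stationary start on \<open>S\<close>. Since
  \<open>metro_surv\<close> recurses on the first step, one more step averages
  \<open>vertex_update_flow\<close> over the uniform vertex \<open>v\<close> and costs at most the
  weight of \<open>G\<close>.\<close>

lemma metro_surv_flow:
  assumes lam: "lam > 1" and N: "N \<ge> 1" and finS: "finite S" and finG: "finite G"
    and cl: "\<And>K. K \<in> S \<Longrightarrow> is_clique N d E K"
    and small: "\<And>K. K \<in> S \<Longrightarrow> int (card K) < M"
    and down: "\<And>K v. K \<in> S \<Longrightarrow> K - {v} \<in> S"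
    and exit: "\<And>K v. K \<in> S \<Longrightarrow> is_clique N d E (insert v K) \<Longrightarrow> insert v K \<notin> S \<Longrightarrow> insert v K \<in> G"
  shows "(\<Sum>K\<in>S. lam ^ card K * metro_surv N d E lam M t K)
           \<ge> (\<Sum>K\<in>S. lam ^ card K) - real t * (\<Sum>K\<in>G. lam ^ card K)"
proof (induction t)
  case 0
  have "(\<Sum>K\<in>S. lam ^ card K * metro_surv N d E lam M 0 K) = (\<Sum>K\<in>S. lam ^ card K)"
    using small by (intro sum.cong) (auto simp: not_le[symmetric])
  then show ?case by simp
next
  case (Suc t)
  let ?g = "\<lambda>K. metro_surv N d E lam M t K"
  let ?s = "\<lambda>K v. (if v \<notin> K then (if is_clique N d E (insert v K) then ?g (insert v K) else ?g K)
           else (1 / lam) * ?g (K - {v}) + (1 - 1 / lam) * ?g K)"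
  have "(\<Sum>K\<in>S. lam ^ card K * metro_surv N d E lam M (Suc t) K)
      = (\<Sum>K\<in>S. \<Sum>v\<in>{1..N}. lam ^ card K * ?s K v / real N)"
  proof (rule sum.cong)
    fix K assume "K \<in> S"
    then have "\<not> M \<le> int (card K)" using small by fastforce
    then show "lam ^ card K * metro_surv N d E lam M (Suc t) K
        = (\<Sum>v\<in>{1..N}. lam ^ card K * ?s K v / real N)"
      unfolding metro_surv.simps
      by (simp only: if_False sum_distrib_left sum_divide_distrib times_divide_eq_right)
  qed simp
  also have "\<dots> = (\<Sum>v\<in>{1..N}. \<Sum>K\<in>S. lam ^ card K * ?s K v / real N)"
    by (rule sum.swap)
  also have "\<dots> = (\<Sum>v\<in>{1..N}. (\<Sum>K\<in>S. lam ^ card K * ?s K v) / real N)"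
    by (simp only: sum_divide_distrib)
  also have "\<dots> \<ge> (\<Sum>v\<in>{1..N}. ((\<Sum>K\<in>S. lam ^ card K * ?g K) - (\<Sum>K\<in>G. lam ^ card K)) / real N)"
    by (intro sum_mono divide_right_mono
          vertex_update_flow[OF lam finS finG cl down exit metro_surv_bounds[OF lam N]]) auto
  also have "(\<Sum>v\<in>{1..N}. ((\<Sum>K\<in>S. lam ^ card K * ?g K) - (\<Sum>K\<in>G. lam ^ card K)) / real N)
      = (\<Sum>K\<in>S. lam ^ card K * ?g K) - (\<Sum>K\<in>G. lam ^ card K)" using N by simp
  finally show ?case using Suc.IH by (simp add: algebra_simps)
qed

section \<open>Gateways and the barrier at size \<open>k\<close>\<close>

definition adj :: "nat \<Rightarrow> nat \<Rightarrow> nat set set \<Rightarrow> nat \<Rightarrow> (nat set \<times> nat set) set" where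
  "adj N d E k = {(K, K'). is_clique N d E K \<and> is_clique N d E K' \<and> k \<le> card K \<and> k \<le> card K' \<and>
       (\<exists>v. K' = insert v K \<or> K = insert v K')}"

text \<open>The cliques already past the barrier; those of size exactly \<open>k\<close> are the
  gateways. By closure under \<open>adj\<close>, a move into this set from outside must start below
  size \<open>k\<close>, hence end at a gateway.\<close>

definition deep :: "nat \<Rightarrow> nat \<Rightarrow> nat set set \<Rightarrow> nat \<Rightarrow> int \<Rightarrow> nat set set" where
  "deep N d E k M = {K. is_clique N d E K \<and> k \<le> card K \<and>
       (\<exists>K'. (K, K') \<in> (adj N d E k)\<^sup>* \<and> M \<le> int (card K'))}"

lemma deep_step: "(K, K') \<in> adj N d E k \<Longrightarrow> K' \<in> deep N d E k M \<Longrightarrow> K \<in> deep N d E k M"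
  unfolding deep_def by (auto simp: adj_def intro: converse_rtrancl_into_rtrancl)

text \<open>Along a path from \<open>K\<close> to a large clique the number of vertices outside \<open>K\<close> changes by at most
  one per step, so it equals \<open>b\<close> somewhere.\<close>

lemma gateway_partner:
  assumes K: "K \<in> deep N d E k M" "card K = k" and M: "int (k + b) \<le> M" and b: "b \<le> k"
  shows "\<exists>K'. (K, K') \<in> clique_pairs N d E k b"
proof -
  have clK: "is_clique N d E K" using K by (auto simp: deep_def)
  then have finK: "finite K" by (rule is_clique_finite)
  obtain L where L: "(K, L) \<in> (adj N d E k)\<^sup>*" "M \<le> int (card L)"
    using K by (auto simp: deep_def)
  \<comment> \<open>The second alternative stores a witness once it is found, since later steps of
    the path may move the count away from \<open>b\<close> again.\<close>
  let ?P = "\<lambda>L. is_clique N d E L \<and>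
    (card (L - K) < b \<or> (\<exists>A. is_clique N d E A \<and> k \<le> card A \<and> card (A - K) = b))"
  from L(1) have "?P L"
  proof (induction rule: rtrancl_induct)
    case base
    show ?case
    proof (cases "b = 0")
      case True
      then show ?thesis using clK K by auto
    next
      case False
      then show ?thesis using clK by simp
    qed
  next
    case (step L1 L2)
    have cl2: "is_clique N d E L2" "k \<le> card L2" using step.hyps by (auto simp: adj_def)
    show ?case
    proof (cases "\<exists>A. is_clique N d E A \<and> k \<le> card A \<and> card (A - K) = b")
      case False
      then have lt: "card (L1 - K) < b" using step.IH by blast
      obtain v where v: "L2 = insert v L1 \<or> L1 = insert v L2" using step.hyps by (auto simp: adj_def)
      have fin: "finite L1" "finite L2" using step.IH cl2 is_clique_finite by blast+
      have "card (L2 - K) \<le> Suc (card (L1 - K))"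
      proof -
        have "L2 - K \<subseteq> insert v (L1 - K)" using v by auto
        then have "card (L2 - K) \<le> card (insert v (L1 - K))" using fin by (intro card_mono) auto
        also have "\<dots> \<le> Suc (card (L1 - K))" by (rule card_insert_le_m1) auto
        finally show ?thesis .
      qed
      moreover have "card (L2 - K) \<noteq> b" using False cl2 by blast
      ultimately show ?thesis using lt cl2 by simp
    qed (use cl2 in blast)
  qed
  moreover have "\<not> card (L - K) < b"
  proof -
    have "card L \<le> card (L - K) + card K"
      by (metis calculation card_Un_le finK Un_Diff_cancel2 card_mono finite_Diff finite_UnI
          is_clique_finite le_trans Un_upper1)
    then show ?thesis using L(2) M K(2) by linarith
  qed
  ultimately obtain A where A: "is_clique N d E A" "k \<le> card A" "card (A - K) = b" by blast
  have finA: "finite A" using A is_clique_finite by blast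
  have "card A = card (A - K) + card (A \<inter> K)"
    using finA by (metis add.commute card_Int_Diff)
  \<comment> \<open>Discarding only vertices of \<open>K\<close> trims \<open>A\<close> to size
    \<open>k\<close> while keeping all \<open>b\<close> new vertices.\<close>
  then have "k - b \<le> card (A \<inter> K)" using A by linarith
  then obtain I where I: "I \<subseteq> A \<inter> K" "card I = k - b" by (meson obtain_subset_with_card_n)
  have finI: "finite I" using I finA by (meson finite_Int finite_subset)
  let ?K' = "(A - K) \<union> I"
  have "card ?K' = k" using A I b finA finI by (subst card_Un_disjoint) auto
  moreover have "K \<inter> ?K' = I" using I by auto
  moreover have "is_clique N d E ?K'" using A(1) by (rule is_clique_subset) (use I in auto)
  ultimately have "(K, ?K') \<in> clique_pairs N d E k b"
    using clK K I by (simp add: clique_pairs_def kcliques_def)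
  then show ?thesis by blast
qed

lemma finite_clique_pairs: "finite (clique_pairs N d E k b)"
proof (rule finite_subset)
  show "clique_pairs N d E k b \<subseteq> kcliques N d E k \<times> kcliques N d E k"
    by (auto simp: clique_pairs_def)
qed (auto simp: kcliques_def finite_cliques)

lemma card_gateways_le:
  assumes "int (k + b) \<le> M" "b \<le> k"
  shows "card {K \<in> deep N d E k M. card K = k} \<le> card (clique_pairs N d E k b)"
proof -
  have "{K \<in> deep N d E k M. card K = k} \<subseteq> fst ` clique_pairs N d E k b"
    using gateway_partner[OF _ _ assms] by force
  then have "card {K \<in> deep N d E k M. card K = k} \<le> card (fst ` clique_pairs N d E k b)"
    by (intro card_mono) (auto simp: finite_clique_pairs)
  then show ?thesis using card_image_le[OF finite_clique_pairs] le_trans by blast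
qed

text \<open>Start in \<open>S\<close> with probability proportional to \<open>lam ^ card K\<close>.
  Each step loses at most the weight of the gateways, which is at most \<open>2 * q\<close> times
  the weight of \<open>S\<close>, so at least half of the mass survives every \<open>t < T\<close>,
  and some state of \<open>S\<close> does as well as the average. The powers of \<open>lam\<close>
  cancel because gateways and \<open>k\<close>-cliques have the same size.\<close>

lemma slow_initial_state:
  assumes lam: "lam > 1" and N: "N \<ge> 1" and M: "int (k + b) \<le> M" and b: "b \<le> k" and k: "k \<ge> 1"
    and pairs: "real (card (clique_pairs N d E k b)) \<le> q * real (card (kcliques N d E k))"
    and ne: "kcliques N d E k \<noteq> {}" and q: "q \<le> 1/2" and T: "real T * q \<le> 1/4"
  shows "\<exists>K0. is_clique N d E K0 \<and> ennreal (real T / 2) \<le> metro_expected_hit N d E lam M K0"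
proof -
  define G where "G = {K \<in> deep N d E k M. card K = k}"
  define S where "S = {K. is_clique N d E K \<and> K \<notin> deep N d E k M}"
  define A where "A = kcliques N d E k"
  define w where "w = (\<lambda>K::nat set. lam ^ card K)"
  have fin: "finite G" "finite S" "finite A"
    unfolding G_def S_def A_def deep_def kcliques_def conj_assoc mem_Collect_eq by (rule finite_cliques)+
  have wpos: "0 < w K" for K using lam by (simp add: w_def)
  have small: "int (card K) < M" if "K \<in> S" for K
  proof (rule ccontr)
    assume "\<not> int (card K) < M"
    then have "K \<in> deep N d E k M" using that M by (auto simp: deep_def S_def)
    then show False using that by (auto simp: S_def)
  qed
  \<comment> \<open>A deep \<open>K - {v}\<close> has size at least \<open>k\<close>, so
    \<open>K\<close> is adjacent or equal to it and would be deep too.\<close>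
  have down: "K - {v} \<in> S" if "K \<in> S" for K v
  proof (rule ccontr)
    assume *: "K - {v} \<notin> S"
    have cl: "is_clique N d E K" "is_clique N d E (K - {v})"
      using that is_clique_subset[of N d E K "K - {v}"] by (auto simp: S_def)
    then have D: "K - {v} \<in> deep N d E k M" using * by (auto simp: S_def)
    have "card (K - {v}) \<le> card K" using cl is_clique_finite by (intro card_mono) auto
    then have "(K, K - {v}) \<in> adj N d E k \<or> K = K - {v}"
      using D cl unfolding adj_def deep_def by (cases "v \<in> K") (auto simp: insert_absorb)
    then show False using deep_step D that by (auto simp: S_def)
  qed
  \<comment> \<open>A clique of size at least \<open>k\<close> that steps to a deep one is itself
    deep, so the crossing goes from size \<open>k - 1\<close> to size \<open>k\<close>.\<close>
  have exit: "insert v K \<in> G" if "K \<in> S" "is_clique N d E (insert v K)" "insert v K \<notin> S" for K v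
  proof -
    have D: "insert v K \<in> deep N d E k M" using that by (auto simp: S_def)
    have vK: "v \<notin> K" using that by (auto simp: insert_absorb)
    have finK: "finite K" using that is_clique_finite by (auto simp: S_def)
    have "(K, insert v K) \<notin> adj N d E k" using deep_step D that by (auto simp: S_def)
    then have "card K < k" using D that by (fastforce simp: adj_def deep_def S_def)
    then have "card (insert v K) = k" using D vK finK by (auto simp: deep_def)
    then show ?thesis using D by (simp add: G_def)
  qed
  have wA: "(\<Sum>K\<in>A. w K) = real (card A) * lam ^ k" by (simp add: w_def A_def kcliques_def)
  have wG: "(\<Sum>K\<in>G. w K) = real (card G) * lam ^ k" by (simp add: w_def G_def)
  have "real (card G) \<le> q * real (card A)"
    using card_gateways_le[OF M b, of N d E] pairs by (simp add: G_def A_def)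
  then have GA: "(\<Sum>K\<in>G. w K) \<le> q * (\<Sum>K\<in>A. w K)"
    using lam unfolding wA wG by (simp add: mult.assoc[symmetric] mult_right_mono)
  \<comment> \<open>Every \<open>k\<close>-clique lies in \<open>S\<close> or is a gateway. As
    gateways carry at most half of the weight of \<open>A\<close>, \<open>S\<close> carries at least
    the other half.\<close>
  have "(\<Sum>K\<in>A. w K) \<le> (\<Sum>K\<in>S \<union> G. w K)"
    using fin wpos by (intro sum_mono2) (auto simp: A_def S_def G_def kcliques_def less_imp_le)
  also have "\<dots> = (\<Sum>K\<in>S. w K) + (\<Sum>K\<in>G. w K)"
    using fin by (intro sum.union_disjoint) (auto simp: S_def G_def)
  finally have AS: "(\<Sum>K\<in>A. w K) \<le> (\<Sum>K\<in>S. w K) + (\<Sum>K\<in>G. w K)" .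
  have Apos: "0 < (\<Sum>K\<in>A. w K)" using fin ne wpos by (intro sum_pos) (auto simp: A_def)
  have "q * (\<Sum>K\<in>A. w K) \<le> 1/2 * (\<Sum>K\<in>A. w K)" using q Apos by (intro mult_right_mono) auto
  then have half: "(\<Sum>K\<in>A. w K) \<le> 2 * (\<Sum>K\<in>S. w K)" using AS GA by linarith
  then have Spos: "0 < (\<Sum>K\<in>S. w K)" using Apos by linarith
  have "real T * (\<Sum>K\<in>G. w K) \<le> real T * (q * (\<Sum>K\<in>A. w K))" using GA by (intro mult_left_mono) auto
  also have "\<dots> = (real T * q) * (\<Sum>K\<in>A. w K)" by simp
  also have "\<dots> \<le> 1/4 * (\<Sum>K\<in>A. w K)" using T Apos by (intro mult_right_mono) auto
  finally have TG: "real T * (\<Sum>K\<in>G. w K) \<le> (\<Sum>K\<in>S. w K) / 2" using half by linarith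
  have Gnn: "0 \<le> (\<Sum>K\<in>G. w K)" using wpos by (intro sum_nonneg) (simp add: less_imp_le)
  have each: "(\<Sum>K\<in>S. w K * metro_surv N d E lam M t K) \<ge> (\<Sum>K\<in>S. w K) / 2" if "t < T" for t
  proof -
    have "real t * (\<Sum>K\<in>G. w K) \<le> real T * (\<Sum>K\<in>G. w K)"
      using that Gnn by (intro mult_right_mono) auto
    moreover have "(\<Sum>K\<in>S. w K * metro_surv N d E lam M t K)
        \<ge> (\<Sum>K\<in>S. w K) - real t * (\<Sum>K\<in>G. w K)"
      unfolding w_def
      by (rule metro_surv_flow[OF lam N fin(2,1)]) (use small down exit in \<open>auto simp: S_def\<close>)
    ultimately show ?thesis using TG by linarith
  qed
  \<comment> \<open>The sum over \<open>t < T\<close> is the expected hitting time truncated at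
    \<open>T\<close>; by \<open>each\<close>, its weighted average over \<open>S\<close> is at least
    \<open>T / 2\<close>.\<close>
  have "\<exists>K0\<in>S. real T / 2 \<le> (\<Sum>t<T. metro_surv N d E lam M t K0)"
  proof (rule ccontr)
    assume "\<not> ?thesis"
    then have lt: "(\<Sum>t<T. metro_surv N d E lam M t K) < real T / 2" if "K \<in> S" for K
      using that by force
    have "S \<noteq> {}" using Spos by auto
    then have "(\<Sum>K\<in>S. w K * (\<Sum>t<T. metro_surv N d E lam M t K)) < (\<Sum>K\<in>S. w K * (real T / 2))"
      using lt wpos fin by (intro sum_strict_mono mult_strict_left_mono) auto
    also have "\<dots> = (\<Sum>t<T. (\<Sum>K\<in>S. w K) / 2)" by (simp add: sum_distrib_left sum_divide_distrib algebra_simps)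
    also have "\<dots> \<le> (\<Sum>t<T. \<Sum>K\<in>S. w K * metro_surv N d E lam M t K)"
      using each by (intro sum_mono) auto
    also have "\<dots> = (\<Sum>K\<in>S. w K * (\<Sum>t<T. metro_surv N d E lam M t K))"
      unfolding sum_distrib_left by (rule sum.swap)
    finally show False by simp
  qed
  then obtain K0 where K0: "K0 \<in> S" "real T / 2 \<le> (\<Sum>t<T. metro_surv N d E lam M t K0)" by blast
  have "ennreal (real T / 2) \<le> ennreal (\<Sum>t<T. metro_surv N d E lam M t K0)"
    using K0 by (intro ennreal_leI)
  also have "\<dots> = (\<Sum>t<T. ennreal (metro_surv N d E lam M t K0))"
    using metro_surv_bounds[OF lam N] by (simp add: sum_ennreal)
  also have "\<dots> \<le> metro_expected_hit N d E lam M K0"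
    unfolding metro_expected_hit_def by (intro sum_le_suminf) auto
  finally show ?thesis using K0 by (auto simp: S_def)
qed

section \<open>Moments of clique counts\<close>

lemma card_dfaces: "finite K \<Longrightarrow> card (dfaces d K) = card K choose d"
  unfolding dfaces_def by (rule n_subsets)

lemma finite_dfaces: "finite K \<Longrightarrow> finite (dfaces d K)"
  unfolding dfaces_def by simp

lemma dfaces_Int: "dfaces d K \<inter> dfaces d K' = dfaces d (K \<inter> K')"
  by (auto simp: dfaces_def)

lemma card_dfaces_Un:
  assumes "finite K" "finite K'" "card K = k" "card K' = k"
  shows "card (dfaces d K \<union> dfaces d K') + (card (K \<inter> K') choose d) = 2 * (k choose d)"
  using card_Un_Int[of "dfaces d K" "dfaces d K'"] assms
  by (simp add: dfaces_Int card_dfaces finite_dfaces)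

text \<open>Only the members of \<open>D - F\<close> remain free: a uniform subset of
  \<open>D\<close> contains \<open>F\<close> with probability \<open>1 / 2 ^ card F\<close>.\<close>

lemma card_Pow_supersets:
  assumes D: "finite D" and F: "F \<subseteq> D"
  shows "real (card {E \<in> Pow D. F \<subseteq> E}) = 2 ^ card D / 2 ^ card F"
proof -
  have finF: "finite F" using D F finite_subset by blast
  have "bij_betw (\<lambda>E. E \<union> F) (Pow (D - F)) {E \<in> Pow D. F \<subseteq> E}"
    by (rule bij_betw_byWitness[where f' = "\<lambda>E. E - F"]) (use F in auto)
  then have "card {E \<in> Pow D. F \<subseteq> E} = card (Pow (D - F))" by (simp add: bij_betw_same_card)
  also have "\<dots> = 2 ^ (card D - card F)" using D F finF by (simp add: card_Pow card_Diff_subset)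
  finally have "card {E \<in> Pow D. F \<subseteq> E} = 2 ^ (card D - card F)" .
  then have "real (card {E \<in> Pow D. F \<subseteq> E}) = 2 ^ (card D - card F)" by simp
  also have "\<dots> = 2 ^ card D / 2 ^ card F" using card_mono[OF D F] by (intro power_diff) auto
  finally show ?thesis .
qed

text \<open>Lowering both entries once more multiplies the coefficient by
  \<open>(k - w) / (n - w)\<close>, which is at most \<open>k / n\<close> because
  \<open>k \<le> n\<close>.\<close>

lemma binomial_shift_le:
  assumes "w \<le> k" "k \<le> n" "0 < n"
  shows "real ((n - w) choose (k - w)) \<le> real (n choose k) * (real k / real n) ^ w"
  using assms(1)
proof (induction w)
  case (Suc w)
  then have w: "w < k" "w < n" using assms by auto
  have "(k - w) * ((n - w) choose (k - w)) = (n - w) * ((n - Suc w) choose (k - Suc w))"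
    using binomial_absorption[of "k - Suc w" "n - w"] w
    by (simp add: Suc_diff_Suc)
  then have "real (k - w) * real ((n - w) choose (k - w))
      = real (n - w) * real ((n - Suc w) choose (k - Suc w))"
    by (metis of_nat_mult)
  then have "real ((n - Suc w) choose (k - Suc w))
      = real (k - w) / real (n - w) * real ((n - w) choose (k - w))"
    using w by (simp add: field_simps)
  also have "\<dots> \<le> real k / real n * real ((n - w) choose (k - w))"
  proof (rule mult_right_mono)
    have "real w * real k \<le> real w * real n" using assms by (intro mult_left_mono) auto
    then show "real (k - w) / real (n - w) \<le> real k / real n"
      using w assms by (simp add: of_nat_diff field_simps)
  qed simp
  also have "\<dots> \<le> real k / real n * (real (n choose k) * (real k / real n) ^ w)"
    using Suc by (intro mult_left_mono) auto
  finally show ?case by (simp add: mult_ac)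
qed simp

text \<open>Removing \<open>W\<close> from \<open>C\<close> leaves a shifted binomial coefficient.
  The bound is the one that independent points of density \<open>k / card V\<close> would
  give.\<close>

lemma card_supersets_le:
  assumes V: "finite V" "V \<noteq> {}" and W: "W \<subseteq> V" and k: "k \<le> card V"
  shows "real (card {C. C \<subseteq> V \<and> card C = k \<and> W \<subseteq> C})
           \<le> real (card V choose k) * (real k / real (card V)) ^ card W"
proof (cases "card W \<le> k")
  case True
  have finW: "finite W" using V W finite_subset by blast
  have "bij_betw (\<lambda>C. C \<union> W) {C. C \<subseteq> V - W \<and> card C = k - card W} {C. C \<subseteq> V \<and> card C = k \<and> W \<subseteq> C}"
  proof (rule bij_betw_byWitness[where f' = "\<lambda>E. E - W"])
    show "(\<lambda>C. C \<union> W) ` {C. C \<subseteq> V - W \<and> card C = k - card W} \<subseteq> {C. C \<subseteq> V \<and> card C = k \<and> W \<subseteq> C}"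
    proof clarify
      fix C assume C: "C \<subseteq> V - W" "card C = k - card W"
      then have "card (C \<union> W) = card C + card W"
        using V finW by (intro card_Un_disjoint) (auto intro: finite_subset[of _ V])
      then show "C \<union> W \<subseteq> V \<and> card (C \<union> W) = k \<and> W \<subseteq> C \<union> W" using C W True by auto
    qed
    show "(\<lambda>E. E - W) ` {C. C \<subseteq> V \<and> card C = k \<and> W \<subseteq> C} \<subseteq> {C. C \<subseteq> V - W \<and> card C = k - card W}"
      using finW by (auto simp: card_Diff_subset)
  qed auto
  then have "card {C. C \<subseteq> V \<and> card C = k \<and> W \<subseteq> C} = card {C. C \<subseteq> V - W \<and> card C = k - card W}"
    by (simp add: bij_betw_same_card)
  also have "\<dots> = (card V - card W) choose (k - card W)"
    using V W finW by (simp add: n_subsets card_Diff_subset)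
  finally show ?thesis using binomial_shift_le[OF True k] V by (simp add: card_gt_0_iff)
next
  case False
  have "{C. C \<subseteq> V \<and> card C = k \<and> W \<subseteq> C} = {}"
    using False V by (auto dest: card_mono[rotated] finite_subset)
  then have "card {C. C \<subseteq> V \<and> card C = k \<and> W \<subseteq> C} = 0" by (simp only: card.empty)
  then show ?thesis by simp
qed

lemma sum_Pow_power_card:
  fixes x :: real
  assumes "finite U"
  shows "(\<Sum>W\<in>Pow U. x ^ card W) = (1 + x) ^ card U"
proof -
  have "(\<Prod>_\<in>U. x + 1) = (\<Sum>W\<in>Pow U. (\<Prod>_\<in>W. x) * (\<Prod>_\<in>U - W. 1))"
    using assms by (rule prod_add)
  then show ?thesis by (simp add: add.commute)
qed

text \<open>The premise \<open>dom\<close> replaces the exponent \<open>j choose d\<close> by one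
  linear in \<open>j\<close>, after which the average over \<open>C\<close> becomes a binomial
  expansion. It is applied with \<open>C\<close> a second \<open>k\<close>-set, for the second
  moment, and with \<open>C\<close> the planted clique.\<close>

lemma sum_uniform_subset_le:
  fixes R :: real
  assumes V: "finite V" "V \<noteq> {}" and U: "U \<subseteq> V" and k: "k \<le> card V" and R: "0 \<le> R"
    and dom: "\<And>j. j \<le> card U \<Longrightarrow> 2 ^ (j choose d) \<le> R ^ j"
  shows "(\<Sum>C\<in>{C. C \<subseteq> V \<and> card C = k}. 2 ^ (card (U \<inter> C) choose d))
           \<le> real (card V choose k) * (1 + real k * R / real (card V)) ^ card U"
proof -
  let ?CC = "{C. C \<subseteq> V \<and> card C = k}"
  have finU: "finite U" using U V finite_subset by blast
  have finC: "finite ?CC" using V by simp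
  \<comment> \<open>Bound the single term \<open>W = U \<inter> C\<close> by the sum over all \<open>W \<subseteq> U \<inter> C\<close>, which is
    multiplicative after averaging over \<open>C\<close>.\<close>
  have "(\<Sum>C\<in>?CC. 2 ^ (card (U \<inter> C) choose d)) \<le> (\<Sum>C\<in>?CC. \<Sum>W\<in>Pow U. if W \<subseteq> C then R ^ card W else 0)"
  proof (rule sum_mono)
    fix C
    have "2 ^ (card (U \<inter> C) choose d) \<le> R ^ card (U \<inter> C)"
      using finU by (intro dom card_mono) auto
    also have "\<dots> = (\<Sum>W\<in>{U \<inter> C}. if W \<subseteq> C then R ^ card W else 0)" by simp
    also have "\<dots> \<le> (\<Sum>W\<in>Pow U. if W \<subseteq> C then R ^ card W else 0)"
      using finU R by (intro sum_mono2) auto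
    finally show "2 ^ (card (U \<inter> C) choose d) \<le> (\<Sum>W\<in>Pow U. if W \<subseteq> C then R ^ card W else 0)" .
  qed
  also have "\<dots> = (\<Sum>W\<in>Pow U. \<Sum>C\<in>?CC. if W \<subseteq> C then R ^ card W else 0)" by (rule sum.swap)
  also have "\<dots> = (\<Sum>W\<in>Pow U. real (card {C. C \<subseteq> V \<and> card C = k \<and> W \<subseteq> C}) * R ^ card W)"
  proof (rule sum.cong)
    fix W
    have "(\<Sum>C\<in>?CC. if W \<subseteq> C then R ^ card W else 0) = (\<Sum>C\<in>?CC \<inter> {C. W \<subseteq> C}. R ^ card W)"
      using finC by (subst sum.inter_restrict) (auto intro: sum.cong)
    also have "?CC \<inter> {C. W \<subseteq> C} = {C. C \<subseteq> V \<and> card C = k \<and> W \<subseteq> C}" by auto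
    finally show "(\<Sum>C\<in>?CC. if W \<subseteq> C then R ^ card W else 0)
        = real (card {C. C \<subseteq> V \<and> card C = k \<and> W \<subseteq> C}) * R ^ card W" by simp
  qed simp
  also have "\<dots> \<le> (\<Sum>W\<in>Pow U. real (card V choose k) * (real k / real (card V)) ^ card W * R ^ card W)"
    using U R by (intro sum_mono mult_right_mono card_supersets_le V k) auto
  also have "\<dots> = real (card V choose k) * (\<Sum>W\<in>Pow U. (real k * R / real (card V)) ^ card W)"
    by (simp add: sum_distrib_left power_mult_distrib power_divide mult_ac)
  also have "\<dots> = real (card V choose k) * (1 + real k * R / real (card V)) ^ card U"
    using sum_Pow_power_card[OF finU] by simp
  finally show ?thesis .
qed

section \<open>First and second moment of the number of \<open>k\<close>-cliques before
  planting\<close>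

lemma card_sum_indicator: "finite A \<Longrightarrow> real (card {x \<in> A. P x}) = (\<Sum>x\<in>A. of_bool (P x))"
  by (simp add: Int_def)

lemma finite_dsets: "finite (dsets N d)"
  by (simp add: dsets_def)

lemma dfaces_subset_dsets: "K \<subseteq> {1..N} \<Longrightarrow> dfaces d K \<subseteq> dsets N d"
  by (auto simp: dfaces_def dsets_def)

definition ksets :: "nat \<Rightarrow> nat \<Rightarrow> nat set set" where
  "ksets N k = {K. K \<subseteq> {1..N} \<and> card K = k}"

lemma finite_ksets: "finite (ksets N k)"
  by (simp add: ksets_def)

lemma card_ksets: "card (ksets N k) = N choose k"
  using n_subsets[of "{1..N}" k] by (simp add: ksets_def)

lemma ksetsD:
  assumes "K \<in> ksets N k"
  shows "finite K" "card K = k" "K \<subseteq> {1..N}"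
  using assms finite_subset[of K "{1..N}"] by (auto simp: ksets_def)

lemma card_kcliques:
  "real (card (kcliques N d E k)) = (\<Sum>K\<in>ksets N k. of_bool (dfaces d K \<subseteq> E))"
proof -
  have "kcliques N d E k = {K \<in> ksets N k. dfaces d K \<subseteq> E}"
    by (auto simp: kcliques_def ksets_def is_clique_iff)
  then show ?thesis using card_sum_indicator[OF finite_ksets] by simp
qed

lemma sum_kcliques:
  "(\<Sum>E\<in>Pow (dsets N d). real (card (kcliques N d E k)))
     = real (N choose k) * 2 ^ card (dsets N d) / 2 ^ (k choose d)"
proof -
  have "(\<Sum>E\<in>Pow (dsets N d). real (card (kcliques N d E k)))
      = (\<Sum>K\<in>ksets N k. \<Sum>E\<in>Pow (dsets N d). of_bool (dfaces d K \<subseteq> E))"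
    unfolding card_kcliques by (rule sum.swap)
  also have "\<dots> = (\<Sum>K\<in>ksets N k. 2 ^ card (dsets N d) / 2 ^ (k choose d))"
  proof (rule sum.cong)
    fix K assume K: "K \<in> ksets N k"
    then have "dfaces d K \<subseteq> dsets N d" by (intro dfaces_subset_dsets) (auto simp: ksets_def)
    then have "real (card {E \<in> Pow (dsets N d). dfaces d K \<subseteq> E}) = 2 ^ card (dsets N d) / 2 ^ card (dfaces d K)"
      by (intro card_Pow_supersets finite_dsets)
    moreover have "card (dfaces d K) = k choose d"
      using ksetsD[OF K] by (simp add: card_dfaces)
    ultimately show "(\<Sum>E\<in>Pow (dsets N d). of_bool (dfaces d K \<subseteq> E)) = (2 ^ card (dsets N d) / 2 ^ (k choose d) :: real)"
      using card_sum_indicator[of "Pow (dsets N d)" "\<lambda>E. dfaces d K \<subseteq> E"] finite_dsets by simp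
  qed simp
  finally show ?thesis by (simp add: card_ksets)
qed

text \<open>Two \<open>k\<close>-sets share the hyperedges inside \<open>K \<inter> K'\<close>, so a
  pair is more likely than independence predicts by the factor
  \<open>2 ^ (card (K \<inter> K') choose d)\<close>. Averaging it over \<open>K'\<close> is
  \<open>sum_uniform_subset_le\<close> with \<open>U = K\<close>.\<close>

lemma sum_kcliques_sq:
  fixes R :: real
  assumes N: "0 < N" and k: "k \<le> N" and R: "0 \<le> R"
    and dom: "\<And>j. j \<le> k \<Longrightarrow> 2 ^ (j choose d) \<le> R ^ j"
  shows "(\<Sum>E\<in>Pow (dsets N d). (real (card (kcliques N d E k)))\<^sup>2)
     \<le> 2 ^ card (dsets N d) * (real (N choose k) / 2 ^ (k choose d))\<^sup>2 * (1 + real k * R / real N) ^ k"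
proof -
  let ?D = "dsets N d" and ?c = "k choose d"
  have "(\<Sum>E\<in>Pow ?D. (real (card (kcliques N d E k)))\<^sup>2)
      = (\<Sum>E\<in>Pow ?D. \<Sum>K\<in>ksets N k. \<Sum>K'\<in>ksets N k. of_bool (dfaces d K \<union> dfaces d K' \<subseteq> E))"
    unfolding card_kcliques power2_eq_square sum_product
    by (intro sum.cong) auto
  also have "\<dots> = (\<Sum>K\<in>ksets N k. \<Sum>E\<in>Pow ?D. \<Sum>K'\<in>ksets N k. of_bool (dfaces d K \<union> dfaces d K' \<subseteq> E))"
    by (rule sum.swap)
  also have "\<dots> = (\<Sum>K\<in>ksets N k. \<Sum>K'\<in>ksets N k. \<Sum>E\<in>Pow ?D. of_bool (dfaces d K \<union> dfaces d K' \<subseteq> E))"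
    by (intro sum.cong sum.swap refl)
  also have "\<dots> = (\<Sum>K\<in>ksets N k. \<Sum>K'\<in>ksets N k. 2 ^ card ?D / 2 ^ (2 * ?c) * 2 ^ (card (K \<inter> K') choose d))"
  proof (intro sum.cong refl)
    fix K K' assume K: "K \<in> ksets N k" "K' \<in> ksets N k"
    then have "dfaces d K \<union> dfaces d K' \<subseteq> ?D"
      by (intro Un_least dfaces_subset_dsets) (auto simp: ksets_def)
    then have "real (card {E \<in> Pow ?D. dfaces d K \<union> dfaces d K' \<subseteq> E})
        = 2 ^ card ?D / 2 ^ card (dfaces d K \<union> dfaces d K')"
      by (intro card_Pow_supersets finite_dsets)
    moreover have "card (dfaces d K \<union> dfaces d K') + (card (K \<inter> K') choose d) = 2 * ?c"
      using ksetsD[OF K(1)] ksetsD[OF K(2)] by (intro card_dfaces_Un)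
    then have "(2::real) ^ card (dfaces d K \<union> dfaces d K') * 2 ^ (card (K \<inter> K') choose d) = 2 ^ (2 * ?c)"
      by (simp flip: power_add)
    ultimately have "real (card {E \<in> Pow ?D. dfaces d K \<union> dfaces d K' \<subseteq> E})
        = 2 ^ card ?D / 2 ^ (2 * ?c) * 2 ^ (card (K \<inter> K') choose d)"
      by (metis (no_types, lifting) mult_divide_mult_cancel_right power_not_zero times_divide_eq_left zero_neq_numeral)
    then show "(\<Sum>E\<in>Pow ?D. of_bool (dfaces d K \<union> dfaces d K' \<subseteq> E))
        = (2 ^ card ?D / 2 ^ (2 * ?c) * 2 ^ (card (K \<inter> K') choose d) :: real)"
      using card_sum_indicator[of "Pow ?D" "\<lambda>E. dfaces d K \<union> dfaces d K' \<subseteq> E"] finite_dsets by simp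
  qed
  also have "\<dots> = (\<Sum>K\<in>ksets N k. 2 ^ card ?D / 2 ^ (2 * ?c) * (\<Sum>K'\<in>ksets N k. 2 ^ (card (K \<inter> K') choose d)))"
    by (simp add: sum_distrib_left)
  also have "\<dots> \<le> (\<Sum>K\<in>ksets N k. 2 ^ card ?D / 2 ^ (2 * ?c) *
      (real (N choose k) * (1 + real k * R / real N) ^ k))"
  proof (intro sum_mono mult_left_mono)
    fix K assume K: "K \<in> ksets N k"
    have "(\<Sum>K'\<in>{K'. K' \<subseteq> {1..N} \<and> card K' = k}. 2 ^ (card (K \<inter> K') choose d))
        \<le> real (card {1..N} choose k) * (1 + real k * R / real (card {1..N})) ^ card K"
      by (rule sum_uniform_subset_le) (use K N k R dom in \<open>auto simp: ksets_def\<close>)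
    then show "(\<Sum>K'\<in>ksets N k. 2 ^ (card (K \<inter> K') choose d))
        \<le> real (N choose k) * (1 + real k * R / real N) ^ k"
      using K by (simp add: ksets_def)
  qed auto
  also have "\<dots> = 2 ^ card ?D * (real (N choose k) / 2 ^ ?c)\<^sup>2 * (1 + real k * R / real N) ^ k"
    by (simp add: card_ksets power2_eq_square power_mult power_divide field_simps flip: power_mult_distrib)
  finally show ?thesis .
qed

text \<open>Chebyshev's inequality: the second moment bounds the relative variance by
  \<open>(1 + real k * R / real N) ^ k - 1\<close>, and a deviation of \<open>\<mu> / 2\<close>
  costs the factor 4.\<close>

lemma few_kcliques_bound:
  fixes R :: real
  assumes N: "0 < N" and k: "k \<le> N" and R: "0 \<le> R"
    and dom: "\<And>j. j \<le> k \<Longrightarrow> 2 ^ (j choose d) \<le> R ^ j"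
  defines "\<mu> \<equiv> real (N choose k) / 2 ^ (k choose d)"
  shows "real (card {E \<in> Pow (dsets N d). real (card (kcliques N d E k)) < \<mu> / 2})
     \<le> 4 * ((1 + real k * R / real N) ^ k - 1) * 2 ^ card (dsets N d)"
proof -
  let ?D = "dsets N d"
  define X where "X = (\<lambda>E. real (card (kcliques N d E k)))"
  define B where "B = {E \<in> Pow ?D. X E < \<mu> / 2}"
  have \<mu>: "0 < \<mu>" using k by (simp add: \<mu>_def zero_less_binomial)
  have finB: "finite (Pow ?D)" "B \<subseteq> Pow ?D" using finite_dsets by (auto simp: B_def)
  have s1: "(\<Sum>E\<in>Pow ?D. X E) = \<mu> * 2 ^ card ?D" by (simp add: X_def sum_kcliques \<mu>_def)
  have s2: "(\<Sum>E\<in>Pow ?D. (X E)\<^sup>2) \<le> 2 ^ card ?D * \<mu>\<^sup>2 * (1 + real k * R / real N) ^ k"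
    unfolding X_def \<mu>_def by (rule sum_kcliques_sq) (use assms in auto)
  have "real (card B) * (\<mu> / 2)\<^sup>2 = (\<Sum>E\<in>B. (\<mu> / 2)\<^sup>2)" by simp
  also have "\<dots> \<le> (\<Sum>E\<in>B. (X E - \<mu>)\<^sup>2)"
  proof (rule sum_mono)
    fix E assume "E \<in> B"
    then have "\<mu> / 2 \<le> \<mu> - X E" by (simp add: B_def)
    then have "(\<mu> / 2)\<^sup>2 \<le> (\<mu> - X E)\<^sup>2" using \<mu> by (intro power_mono) auto
    then show "(\<mu> / 2)\<^sup>2 \<le> (X E - \<mu>)\<^sup>2" by (simp add: power2_commute)
  qed
  also have "\<dots> \<le> (\<Sum>E\<in>Pow ?D. (X E - \<mu>)\<^sup>2)" using finB by (intro sum_mono2) auto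
  also have "\<dots> = (\<Sum>E\<in>Pow ?D. (X E)\<^sup>2) - 2 * \<mu> * (\<Sum>E\<in>Pow ?D. X E) + real (card (Pow ?D)) * \<mu>\<^sup>2"
    by (simp add: power2_diff sum.distrib sum_subtractf sum_distrib_left mult_ac)
  also have "\<dots> = (\<Sum>E\<in>Pow ?D. (X E)\<^sup>2) - 2 ^ card ?D * \<mu>\<^sup>2"
    using finite_dsets by (simp add: s1 card_Pow power2_eq_square)
  also have "\<dots> \<le> 2 ^ card ?D * \<mu>\<^sup>2 * ((1 + real k * R / real N) ^ k - 1)"
    using s2 by (simp add: algebra_simps)
  finally have "\<mu>\<^sup>2 * real (card B) \<le> \<mu>\<^sup>2 * (4 * ((1 + real k * R / real N) ^ k - 1) * 2 ^ card ?D)"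
    by (simp add: power2_eq_square field_simps)
  then show ?thesis using \<mu> by (simp add: B_def X_def)
qed

section \<open>Pairs of cliques with prescribed intersection size, after planting\<close>

definition far_pairs :: "nat \<Rightarrow> nat \<Rightarrow> nat \<Rightarrow> (nat set \<times> nat set) set" where
  "far_pairs N k b = {(K, K'). K \<in> ksets N k \<and> K' \<in> ksets N k \<and> card (K \<inter> K') = k - b}"

lemma finite_far_pairs: "finite (far_pairs N k b)"
  by (rule finite_subset[of _ "ksets N k \<times> ksets N k"]) (auto simp: far_pairs_def finite_ksets)

text \<open>Given \<open>K\<close>, the set \<open>K'\<close> is determined by
  \<open>K \<inter> K'\<close>, a subset of \<open>K\<close>, and by \<open>K' - K\<close>, a
  \<open>b\<close>-set.\<close>

lemma card_far_pairs_le: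
  assumes "b \<le> k"
  shows "real (card (far_pairs N k b)) \<le> real (N choose k) * 2 ^ k * real N ^ b"
proof -
  let ?T = "Sigma (ksets N k) (\<lambda>K. Pow K \<times> ksets N b)"
  let ?f = "\<lambda>(K, I, J). (K, I \<union> J)"
  have fin: "finite ?T" by (auto simp: finite_ksets ksetsD)
  have "far_pairs N k b \<subseteq> ?f ` ?T"
  proof clarify
    fix K K' assume "(K, K') \<in> far_pairs N k b"
    then have K: "K \<in> ksets N k" "K' \<in> ksets N k" "card (K \<inter> K') = k - b" by (auto simp: far_pairs_def)
    have "card (K' - K) = b"
    proof -
      have "card (K' - K) = card K' - card (K' \<inter> K)"
        using ksetsD(1)[OF K(1)] by (intro card_Diff_subset_Int) auto
      then show ?thesis using K assms by (simp add: ksets_def Int_commute)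
    qed
    then have "(K, K \<inter> K', K' - K) \<in> ?T" using K by (auto simp: ksets_def)
    moreover have "(K, K') = ?f (K, K \<inter> K', K' - K)" by auto
    ultimately show "(K, K') \<in> ?f ` ?T" by (rule rev_image_eqI)
  qed
  then have "card (far_pairs N k b) \<le> card (?f ` ?T)" using fin by (intro card_mono) auto
  also have "\<dots> \<le> card ?T" using fin by (rule card_image_le)
  also have "\<dots> = (\<Sum>K\<in>ksets N k. 2 ^ k * (N choose b))"
  proof (subst card_SigmaI)
    show "(\<Sum>K\<in>ksets N k. card (Pow K \<times> ksets N b)) = (\<Sum>K\<in>ksets N k. 2 ^ k * (N choose b))"
      by (intro sum.cong refl, subst card_cartesian_product) (simp add: card_ksets card_Pow ksetsD)
  qed (auto simp: finite_ksets ksetsD)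
  also have "\<dots> = (N choose k) * (2 ^ k * (N choose b))" by (simp add: card_ksets)
  also have "\<dots> \<le> (N choose k) * (2 ^ k * N ^ b)"
    using binomial_fact_pow[of N b]
    by (intro mult_left_mono) (auto intro: order_trans[rotated])
  finally have "real (card (far_pairs N k b)) \<le> real ((N choose k) * (2 ^ k * N ^ b))"
    using of_nat_le_iff by blast
  then show ?thesis by (simp add: mult_ac)
qed

text \<open>Planting \<open>C\<close> provides for free the required hyperedges inside
  \<open>C\<close>. They are \<open>d\<close>-subsets of \<open>(K \<union> K') \<inter> C\<close>,
  so the gain is at most \<open>2 ^ (card ((K \<union> K') \<inter> C) choose d)\<close>, averaged
  over \<open>C\<close> by \<open>sum_uniform_subset_le\<close> with
  \<open>U = K \<union> K'\<close> of size \<open>k + b\<close>.\<close>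

lemma sum_clique_pairs_le:
  fixes R :: real
  assumes N: "0 < N" and \<kappa>: "\<kappa> \<le> N" and b: "b \<le> k" and R: "0 \<le> R"
    and dom: "\<And>j. j \<le> k + b \<Longrightarrow> 2 ^ (j choose d) \<le> R ^ j"
  shows "(\<Sum>C\<in>ksets N \<kappa>. \<Sum>E\<in>Pow (dsets N d). real (card (clique_pairs N d (E \<union> dfaces d C) k b)))
     \<le> real (N choose k) * 2 ^ k * real N ^ b * (2 ^ card (dsets N d) * 2 ^ ((k - b) choose d) / 2 ^ (2 * (k choose d)))
        * (real (N choose \<kappa>) * (1 + real \<kappa> * R / real N) ^ (k + b))"
proof -
  let ?D = "dsets N d"
  let ?q = "2 ^ card ?D * 2 ^ ((k - b) choose d) / 2 ^ (2 * (k choose d)) :: real"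
  let ?r = "real (N choose \<kappa>) * (1 + real \<kappa> * R / real N) ^ (k + b)"
  have cp: "real (card (clique_pairs N d E k b))
      = (\<Sum>(K, K')\<in>far_pairs N k b. of_bool (dfaces d K \<union> dfaces d K' \<subseteq> E))" for E
  proof -
    have "clique_pairs N d E k b = {P \<in> far_pairs N k b. (case P of (K, K') \<Rightarrow> dfaces d K \<union> dfaces d K' \<subseteq> E)}"
      by (auto simp: clique_pairs_def far_pairs_def kcliques_def ksets_def is_clique_iff)
    then show ?thesis
      using card_sum_indicator[OF finite_far_pairs[of N k b], of "\<lambda>(K, K'). dfaces d K \<union> dfaces d K' \<subseteq> E"]
      by (simp add: case_prod_unfold)
  qed
  have per_C: "(\<Sum>E\<in>Pow ?D. of_bool (dfaces d K \<union> dfaces d K' \<subseteq> E \<union> dfaces d C))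
      \<le> ?q * 2 ^ (card ((K \<union> K') \<inter> C) choose d)"
    if P: "(K, K') \<in> far_pairs N k b" for K K' C
  proof -
    let ?H = "dfaces d K \<union> dfaces d K'"
    have K: "K \<in> ksets N k" "K' \<in> ksets N k" "card (K \<inter> K') = k - b" using P by (auto simp: far_pairs_def)
    have finK: "finite K" "finite K'" using ksetsD(1)[OF K(1)] ksetsD(1)[OF K(2)] by auto
    have HD: "?H \<subseteq> ?D"
      using K by (intro Un_least dfaces_subset_dsets) (auto simp: ksets_def)
    have finH: "finite ?H" using HD finite_dsets finite_subset by blast
    have e: "card (?H \<inter> dfaces d C) \<le> card ((K \<union> K') \<inter> C) choose d"
    proof -
      have "card (?H \<inter> dfaces d C) \<le> card (dfaces d ((K \<union> K') \<inter> C))"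
        using finK by (intro card_mono finite_dfaces) (auto simp: dfaces_def)
      then show ?thesis using finK by (simp add: card_dfaces)
    qed
    have H: "card ?H + ((k - b) choose d) = 2 * (k choose d)"
      using card_dfaces_Un[OF finK, of k d] K by (simp add: ksets_def)
    have HC: "card ?H = card (?H - dfaces d C) + card (?H \<inter> dfaces d C)"
      using finH by (metis add.commute card_Int_Diff)
    have "(\<Sum>E\<in>Pow ?D. of_bool (?H \<subseteq> E \<union> dfaces d C)) = (\<Sum>E\<in>Pow ?D. of_bool (?H - dfaces d C \<subseteq> E) :: real)"
      by (intro sum.cong refl arg_cong[of _ _ of_bool]) auto
    also have "\<dots> = real (card {E \<in> Pow ?D. ?H - dfaces d C \<subseteq> E})"
      using card_sum_indicator[of "Pow ?D" "\<lambda>E. ?H - dfaces d C \<subseteq> E"] finite_dsets by simp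
    also have "\<dots> = 2 ^ card ?D / 2 ^ card (?H - dfaces d C)"
      using HD by (intro card_Pow_supersets finite_dsets) auto
    also have "\<dots> = 2 ^ card ?D * 2 ^ card (?H \<inter> dfaces d C) / 2 ^ card ?H"
      unfolding HC power_add by simp
    also have "\<dots> = ?q * 2 ^ card (?H \<inter> dfaces d C)"
      unfolding H[symmetric] power_add by simp
    also have "\<dots> \<le> ?q * 2 ^ (card ((K \<union> K') \<inter> C) choose d)"
      using e by (intro mult_left_mono power_increasing) auto
    finally show ?thesis .
  qed
  have per_pair: "(\<Sum>C\<in>ksets N \<kappa>. \<Sum>E\<in>Pow ?D. of_bool (dfaces d K \<union> dfaces d K' \<subseteq> E \<union> dfaces d C)) \<le> ?q * ?r"
    if P: "(K, K') \<in> far_pairs N k b" for K K'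
  proof -
    have K: "K \<in> ksets N k" "K' \<in> ksets N k" "card (K \<inter> K') = k - b" using P by (auto simp: far_pairs_def)
    have finK: "finite K" "finite K'" using ksetsD(1)[OF K(1)] ksetsD(1)[OF K(2)] by auto
    have U: "card (K \<union> K') = k + b"
      using card_Un_Int[OF finK] K b by (simp add: ksets_def)
    have "(\<Sum>C\<in>ksets N \<kappa>. \<Sum>E\<in>Pow ?D. of_bool (dfaces d K \<union> dfaces d K' \<subseteq> E \<union> dfaces d C))
        \<le> (\<Sum>C\<in>ksets N \<kappa>. ?q * 2 ^ (card ((K \<union> K') \<inter> C) choose d))"
      by (intro sum_mono per_C P)
    also have "\<dots> = ?q * (\<Sum>C\<in>ksets N \<kappa>. 2 ^ (card ((K \<union> K') \<inter> C) choose d))"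
      by (simp add: sum_distrib_left)
    also have "\<dots> \<le> ?q * ?r"
    proof (rule mult_left_mono)
      have "(\<Sum>C\<in>{C. C \<subseteq> {1..N} \<and> card C = \<kappa>}. 2 ^ (card ((K \<union> K') \<inter> C) choose d))
          \<le> real (card {1..N} choose \<kappa>) * (1 + real \<kappa> * R / real (card {1..N})) ^ card (K \<union> K')"
        by (rule sum_uniform_subset_le) (use K N \<kappa> R dom U in \<open>auto simp: ksets_def\<close>)
      then show "(\<Sum>C\<in>ksets N \<kappa>. 2 ^ (card ((K \<union> K') \<inter> C) choose d)) \<le> ?r"
        by (simp add: U ksets_def)
    qed simp
    finally show ?thesis .
  qed
  have "(\<Sum>C\<in>ksets N \<kappa>. \<Sum>E\<in>Pow ?D. real (card (clique_pairs N d (E \<union> dfaces d C) k b)))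
      = (\<Sum>P\<in>far_pairs N k b. \<Sum>C\<in>ksets N \<kappa>. \<Sum>E\<in>Pow ?D.
          case P of (K, K') \<Rightarrow> of_bool (dfaces d K \<union> dfaces d K' \<subseteq> E \<union> dfaces d C))"
    unfolding cp
    by (subst (2) sum.swap, subst sum.swap) simp
  also have "\<dots> \<le> (\<Sum>P\<in>far_pairs N k b. ?q * ?r)"
    using per_pair by (intro sum_mono) (auto split: prod.splits)
  also have "\<dots> = real (card (far_pairs N k b)) * (?q * ?r)" by simp
  also have "\<dots> \<le> (real (N choose k) * 2 ^ k * real N ^ b) * (?q * ?r)"
    using R by (intro mult_right_mono card_far_pairs_le b mult_nonneg_nonneg) auto
  finally show ?thesis by (simp only: mult.assoc)
qed

section \<open>Probabilities in the planted model\<close>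

lemma prob_planted:
  assumes "\<kappa> \<le> N"
  shows "measure_pmf.prob (planted_hypergraph N d \<kappa>) A
     = real (card {(C, E). C \<in> ksets N \<kappa> \<and> E \<in> Pow (dsets N d) \<and> E \<union> dfaces d C \<in> A})
        / (real (N choose \<kappa>) * 2 ^ card (dsets N d))"
proof -
  let ?D = "Pow (dsets N d)"
  have ne: "ksets N \<kappa> \<noteq> {}" "?D \<noteq> {}" and fin: "finite (ksets N \<kappa>)" "finite ?D"
    using finite_ksets card_ksets[of N \<kappa>] finite_dsets zero_less_binomial[OF assms] by auto
  \<comment> \<open>Independent uniform choices are uniform on the product, so probabilities become
    counts of pairs \<open>(C, E)\<close>.\<close>
  have pp: "pair_pmf (pmf_of_set (ksets N \<kappa>)) (pmf_of_set ?D) = pmf_of_set (ksets N \<kappa> \<times> ?D)"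
  proof (rule pmf_eqI)
    fix x :: "nat set \<times> nat set set"
    obtain C E where x: "x = (C, E)" by (cases x)
    have ne': "ksets N \<kappa> \<times> ?D \<noteq> {}" using ne by blast
    show "pmf (pair_pmf (pmf_of_set (ksets N \<kappa>)) (pmf_of_set ?D)) x = pmf (pmf_of_set (ksets N \<kappa> \<times> ?D)) x"
      unfolding x pmf_pair pmf_of_set[OF ne(1) fin(1)] pmf_of_set[OF ne(2) fin(2)]
        pmf_of_set[OF ne' finite_cartesian_product[OF fin]]
      by (auto simp: indicator_def card_cartesian_product)
  qed
  have "planted_hypergraph N d \<kappa> = map_pmf (\<lambda>(C, E). E \<union> dfaces d C) (pmf_of_set (ksets N \<kappa> \<times> ?D))"
    unfolding pp[symmetric] by (simp add: planted_hypergraph_def dfaces_def ksets_def)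
  then have "measure_pmf.prob (planted_hypergraph N d \<kappa>) A
      = real (card ((ksets N \<kappa> \<times> ?D) \<inter> ((\<lambda>(C, E). E \<union> dfaces d C) -` A))) / real (card (ksets N \<kappa> \<times> ?D))"
    using ne fin by (simp add: measure_pmf_of_set)
  also have "(ksets N \<kappa> \<times> ?D) \<inter> ((\<lambda>(C, E). E \<union> dfaces d C) -` A)
      = {(C, E). C \<in> ksets N \<kappa> \<and> E \<in> ?D \<and> E \<union> dfaces d C \<in> A}" by auto
  finally show ?thesis using finite_dsets by (simp add: card_cartesian_product card_Pow card_ksets)
qed

text \<open>Two bad events: \<open>B0\<close>, too few cliques before planting, is bounded by
  Chebyshev; \<open>B1\<close>, too many pairs after planting, by Markov at level
  \<open>\<mu> * r\<close>. Outside both there are at least \<open>\<mu> / 2\<close> cliques, whence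
  the ratio \<open>2 * r\<close>.\<close>

lemma prob_many_cliques_few_pairs:
  fixes R r :: real
  assumes N: "0 < N" and \<kappa>: "\<kappa> \<le> N" and k: "k \<le> N" and b: "b \<le> k" and R: "0 \<le> R" and r: "0 < r"
    and dom: "\<And>j. j \<le> k + b \<Longrightarrow> 2 ^ (j choose d) \<le> R ^ j"
  shows "measure_pmf.prob (planted_hypergraph N d \<kappa>)
      {E. kcliques N d E k \<noteq> {} \<and> real (card (clique_pairs N d E k b)) \<le> 2 * r * real (card (kcliques N d E k))}
    \<ge> 1 - 4 * ((1 + real k * R / real N) ^ k - 1)
        - 2 ^ k * real N ^ b * (2 ^ ((k - b) choose d) / 2 ^ (k choose d)) * (1 + real \<kappa> * R / real N) ^ (k + b) / r"
    (is "measure_pmf.prob ?P ?good \<ge> 1 - ?e1 - ?e2")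
proof -
  let ?D = "dsets N d"
  let ?W = "real (N choose \<kappa>) * 2 ^ card ?D"
  define \<mu> where "\<mu> = real (N choose k) / 2 ^ (k choose d)"
  define X where "X = (\<lambda>E. real (card (kcliques N d E k)))"
  define Z where "Z = (\<lambda>C E. real (card (clique_pairs N d (E \<union> dfaces d C) k b)))"
  define B0 where "B0 = {E \<in> Pow ?D. X E < \<mu> / 2}"
  define B1 where "B1 = {(C, E) \<in> ksets N \<kappa> \<times> Pow ?D. \<mu> * r < Z C E}"
  have \<mu>: "0 < \<mu>" using k by (simp add: \<mu>_def zero_less_binomial)
  have W: "0 < ?W" using \<kappa> by (simp add: zero_less_binomial)
  have fin: "finite (ksets N \<kappa> \<times> Pow ?D)" by (simp add: finite_ksets finite_dsets)
  have finB: "finite B0" "finite B1" unfolding B0_def B1_def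
    using finite_dsets by simp (rule finite_subset[OF _ fin], auto)
  have c0: "real (card B0) \<le> ?e1 * 2 ^ card ?D"
    unfolding B0_def X_def \<mu>_def by (rule few_kcliques_bound[OF N k R]) (use dom in simp)
  have c1: "real (card B1) \<le> ?e2 * ?W"
  proof -
    have "real (card B1) * (\<mu> * r) = (\<Sum>(C, E)\<in>B1. \<mu> * r)" by simp
    also have "\<dots> \<le> (\<Sum>(C, E)\<in>B1. Z C E)" by (intro sum_mono) (auto simp: B1_def)
    also have "\<dots> \<le> (\<Sum>(C, E)\<in>ksets N \<kappa> \<times> Pow ?D. Z C E)"
      using fin by (intro sum_mono2) (auto simp: B1_def Z_def)
    also have "\<dots> = (\<Sum>C\<in>ksets N \<kappa>. \<Sum>E\<in>Pow ?D. Z C E)" by (simp add: sum.cartesian_product)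
    also have "\<dots> \<le> real (N choose k) * 2 ^ k * real N ^ b * (2 ^ card ?D * 2 ^ ((k - b) choose d) / 2 ^ (2 * (k choose d)))
        * (real (N choose \<kappa>) * (1 + real \<kappa> * R / real N) ^ (k + b))"
      unfolding Z_def by (rule sum_clique_pairs_le[OF N \<kappa> b R dom])
    also have "\<dots> = (?e2 * ?W) * (\<mu> * r)"
      using r by (simp add: \<mu>_def mult_2 power_add)
    finally have "real (card B1) * (\<mu> * r) \<le> (?e2 * ?W) * (\<mu> * r)" .
    then show ?thesis using mult_pos_pos[OF \<mu> r] mult_le_cancel_right_pos by blast
  qed
  have "measure_pmf.prob ?P (- ?good) \<le> ?e1 + ?e2"
  proof -
    let ?bad = "{(C, E). C \<in> ksets N \<kappa> \<and> E \<in> Pow ?D \<and> E \<union> dfaces d C \<in> - ?good}"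
    have "?bad \<subseteq> ksets N \<kappa> \<times> B0 \<union> B1"
    proof
      fix p assume "p \<in> ?bad"
      then obtain C E where p: "p = (C, E)" and CE: "C \<in> ksets N \<kappa>" "E \<in> Pow ?D" "E \<union> dfaces d C \<notin> ?good"
        by blast
      show "p \<in> ksets N \<kappa> \<times> B0 \<union> B1"
      proof (rule ccontr)
        assume "p \<notin> ksets N \<kappa> \<times> B0 \<union> B1"
        then have notB: "E \<notin> B0" "(C, E) \<notin> B1" using p CE by auto
        then have x: "\<mu> / 2 \<le> X E" using CE by (auto simp: B0_def)
        have z: "Z C E \<le> \<mu> * r" using CE notB by (auto simp: B1_def)
        \<comment> \<open>Planting only adds hyperedges and so preserves cliques; hence the second
          moment is needed for the unplanted \<open>E\<close> only.\<close>
        have "kcliques N d E k \<subseteq> kcliques N d (E \<union> dfaces d C) k"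
          by (auto simp: kcliques_def is_clique_iff)
        then have "X E \<le> X (E \<union> dfaces d C)"
          unfolding X_def kcliques_def by (simp add: card_mono finite_cliques)
        then have x': "\<mu> / 2 \<le> X (E \<union> dfaces d C)" using x by linarith
        then have "kcliques N d (E \<union> dfaces d C) k \<noteq> {}" using \<mu> by (auto simp: X_def)
        moreover have "\<mu> * r \<le> 2 * r * X (E \<union> dfaces d C)"
          using mult_left_mono[OF x', of "2 * r"] r by (simp add: mult_ac)
        ultimately show False using CE z by (auto simp: Z_def X_def)
      qed
    qed
    then have "card ?bad \<le> card (ksets N \<kappa> \<times> B0 \<union> B1)"
      using finB finite_ksets by (intro card_mono) auto
    also have "\<dots> \<le> card (ksets N \<kappa> \<times> B0) + card B1" by (rule card_Un_le)
    finally have "real (card ?bad) \<le> real (N choose \<kappa>) * real (card B0) + real (card B1)"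
      by (simp add: card_cartesian_product card_ksets flip: of_nat_mult of_nat_add)
    also have "\<dots> \<le> real (N choose \<kappa>) * (?e1 * 2 ^ card ?D) + ?e2 * ?W"
      using c0 c1 by (intro add_mono mult_left_mono) auto
    also have "\<dots> = (?e1 + ?e2) * ?W" by (simp add: algebra_simps)
    finally have "real (card ?bad) / ?W \<le> ?e1 + ?e2" using W by (simp add: pos_divide_le_eq)
    then show ?thesis by (simp only: prob_planted[OF \<kappa>])
  qed
  moreover have "measure_pmf.prob ?P (- ?good) = 1 - measure_pmf.prob ?P ?good"
    using measure_pmf.prob_compl[of ?good ?P] by (simp add: Compl_eq_Diff_UNIV)
  ultimately show ?thesis by linarith
qed

section \<open>Choice of sizes and asymptotics\<close>

text \<open>The right side is the falling factorial of \<open>n\<close>; for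
  \<open>r \<le> n\<close> its \<open>r\<close> factors all exceed \<open>n - r\<close>, and for
  \<open>n < r\<close> the truncated difference is 0.\<close>

lemma power_le_binomial_fact: "(n - r) ^ r \<le> (n choose r) * fact r"
proof (induction r arbitrary: n)
  case (Suc r)
  show ?case
  proof (cases n)
    case (Suc m)
    have "(n - Suc r) ^ Suc r = (m - r) * (m - r) ^ r" by (simp add: Suc)
    also have "\<dots> \<le> Suc m * ((m choose r) * fact r)" by (intro mult_mono Suc.IH) auto
    also have "\<dots> = (Suc r * (Suc m choose Suc r)) * fact r"
      unfolding binomial_absorption by (simp add: algebra_simps)
    finally show ?thesis by (simp add: Suc algebra_simps)
  qed auto
qed simp

text \<open>Counts only the subsets with at most one of the \<open>b\<close> extra elements: each
  new vertex brings at least \<open>a choose e\<close> new hyperedges.\<close>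

lemma binomial_add_lower:
  "(a choose Suc e) + b * (a choose e) \<le> (a + b) choose Suc e"
proof (induction b)
  case (Suc b)
  have "(a choose e) \<le> (a + b) choose e" by (rule binomial_right_mono) simp
  then show ?case using Suc by simp
qed simp

text \<open>The quantitative form for a fixed \<open>N\<close>. The expected pair count is at most
  \<open>2 / Y\<^sup>2\<close> times the expected clique count, so taking \<open>r = 1 / Y\<close>
  makes both the Markov error and the gateway proportion at most \<open>2 / Y\<close>.\<close>

lemma prob_slow_ge:
  fixes N d :: nat and \<epsilon> \<beta> \<eta> \<theta> :: real
  defines "L \<equiv> log 2 (real N)" and "p \<equiv> 1 / (real d - 1)" and "F \<equiv> fact (d - 1)"
  defines "T \<equiv> (F * L) powr p" and "Y \<equiv> real N powr (\<eta>\<^sup>2 / 8 * L powr p)"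
  assumes d: "d \<ge> 2" and \<eta>: "0 < \<eta>" "\<eta> \<le> 1" and \<epsilon>: "0 < \<epsilon>"
    and h\<theta>: "(1 + 5 * \<eta>) ^ (d - 1) \<le> 2 * \<theta>" and h\<epsilon>: "(1 + 5 * \<eta>) ^ (d - 1) \<le> 1 + 2/3 * \<epsilon>"
    and \<beta>: "\<beta> \<le> 1"
    and N: "N \<ge> 2" and L: "20 / \<eta>\<^sup>2 \<le> L" and T: "real d + 2 \<le> \<eta> * T"
    and kN: "5 * F * L \<le> real N"
    and h\<kappa>: "5 * F * L * real N powr \<beta> * real N powr \<theta> / real N \<le> 1/2"
    and Y: "400 \<le> Y"
  shows "measure_pmf.prob (planted_hypergraph N d (nat \<lfloor>real N powr \<beta>\<rfloor>))
            {E. \<forall>lam>1. \<exists>K0. is_clique N d E K0 \<and>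
                 ennreal (real N powr (\<eta>\<^sup>2 / 16 * L powr p))
                   < metro_expected_hit N d E lam (m_threshold N d \<epsilon>) K0}
         \<ge> 1 - 4 * (exp ((5 * F * L)\<^sup>2 * real N powr \<theta> / real N) - 1) - 2 / Y"
    (is "measure_pmf.prob ?P ?slow \<ge> _")
proof -
  obtain e where e: "d = Suc e" "e \<ge> 1" using d by (cases d) auto
  have pe: "p * real e = 1" "0 < p" "p \<le> 1" using e by (auto simp: p_def)
  have F: "F = fact e" "1 \<le> F" using e by (auto simp: F_def fact_ge_1)
  have L1: "1 \<le> L" using N by (simp add: L_def)
  have N2: "real N = 2 powr L" using N by (simp add: L_def)
  have FL: "1 \<le> F * L" using mult_mono[of 1 F 1 L] F L1 by simp
  have Tpos: "0 < T" using FL by (auto simp: T_def)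
  \<comment> \<open>Why \<open>T\<close> is critical: joining a vertex to a clique of size
    \<open>T\<close> takes about \<open>T ^ e / F = L\<close> hyperedges, which balances the
    \<open>N = 2 powr L\<close> choices of the vertex.\<close>
  have Te: "T ^ e = F * L"
  proof -
    have "T ^ e = T powr real e" using Tpos by (simp add: powr_realpow)
    also have "\<dots> = (F * L) powr (p * real e)" by (simp add: T_def powr_powr)
    finally show ?thesis using pe FL by simp
  qed
  have TFL: "T \<le> F * L" using powr_mono[of p 1 "F * L"] pe FL by (simp add: T_def)
  have LT: "L powr p \<le> T" unfolding T_def
    using L1 F pe mult_right_mono[of 1 F L] by (intro powr_mono2) auto
  have \<eta>T: "\<eta> * T \<le> T" using \<eta> Tpos by simp

  \<comment> \<open>\<open>a\<close> is the size of the intersection of a gateway with its partner: it still exceeds \<open>(1 + \<eta>) T\<close>,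
    so each of the \<open>b\<close> new vertices costs a factor \<open>N\<^bsup>-(1+\<eta>)\<^esup>\<close> against \<open>N\<close> choices.\<close>
  define a where "a = nat \<lceil>(1 + \<eta>) * T\<rceil> + d"
  define b where "b = nat \<lfloor>\<eta> * T\<rfloor>"
  define k where "k = a + b"
  define \<kappa> where "\<kappa> = nat \<lfloor>real N powr \<beta>\<rfloor>"
  define R where "R = real N powr \<theta>"
  have \<eta>1: "0 \<le> (1 + \<eta>) * T" using \<eta> Tpos by simp
  have a1: "(1 + \<eta>) * T + real d \<le> real a" "real a \<le> (1 + \<eta>) * T + 1 + real d"
    using \<eta>1 unfolding a_def by (auto simp: of_nat_nat)
  have b1: "\<eta> * T - 1 \<le> real b" "real b \<le> \<eta> * T"
    using \<eta> Tpos unfolding b_def by (auto simp: of_nat_nat)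
  have b2: "\<eta> * T / 2 \<le> real b" using b1 T by linarith
  \<comment> \<open>Here \<open>k + b = a + 2 * b\<close>; the rounding and the summand
    \<open>d\<close> in \<open>a\<close> are absorbed by
    \<open>real d + 2 \<le> \<eta> * T\<close>.\<close>
  have m1: "real (k + b) \<le> (1 + 4 * \<eta>) * T"
    using a1 b1 T by (simp add: k_def algebra_simps)
  have m5: "real (k + b) \<le> 5 * T" using m1 \<eta>T by (simp add: algebra_simps)
  have m6: "real (k + b) \<le> 5 * F * L" using m5 TFL by linarith
  have k5: "real k \<le> 5 * T" "real k \<le> 5 * F * L" using m5 m6 by auto
  have m_le: "int (k + b) \<le> m_threshold N d \<epsilon>"
  proof -
    define x1 where "x1 = ((1 + 2/3 * \<epsilon>) * (fact d / 2) * log 2 (real N)) powr (1 / (real d - 1))"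
    define x2 where "x2 = ((1 + 2/3 * \<epsilon>) * fact (d - 1) * log 2 (real N)) powr (1 / (real d - 1))"
    have fd: "fact (d - 1) \<le> (fact d / 2 :: real)"
    proof -
      have "(fact d :: real) = real d * fact (d - 1)" using e by simp
      moreover have "2 * fact (d - 1) \<le> real d * fact (d - 1)" using d by (intro mult_right_mono) auto
      ultimately show ?thesis by linarith
    qed
    \<comment> \<open>The target is at least \<open>2 * x1 - x2 - 1\<close>, so this reduces the
      claim to comparing \<open>k + b\<close> with \<open>x2 - 1\<close>.\<close>
    have "x2 \<le> x1" unfolding x1_def x2_def
      using \<epsilon> L1 fd pe by (intro powr_mono2 mult_right_mono mult_left_mono mult_nonneg_nonneg) (auto simp: L_def p_def)
    have "(1 + 5 * \<eta>) * T = (((1 + 5 * \<eta>) * T) ^ e) powr p"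
    proof -
      have pos: "0 < (1 + 5 * \<eta>) * T" using \<eta> Tpos by simp
      then have "(((1 + 5 * \<eta>) * T) ^ e) powr p = ((1 + 5 * \<eta>) * T) powr (real e * p)"
        by (simp add: powr_powr flip: powr_realpow)
      then show ?thesis using pe pos by (simp add: mult.commute)
    qed
    also have "\<dots> \<le> x2" unfolding x2_def p_def[symmetric]
    proof (rule powr_mono2)
      show "((1 + 5 * \<eta>) * T) ^ e \<le> (1 + 2/3 * \<epsilon>) * fact (d - 1) * log 2 (real N)"
        using mult_right_mono[OF h\<epsilon>, of "F * L"] FL e by (simp add: power_mult_distrib Te F_def L_def mult.assoc)
    qed (use pe \<eta> Tpos in auto)
    finally have "(1 + 5 * \<eta>) * T \<le> x2" .
    moreover have "real_of_int (m_threshold N d \<epsilon>) \<ge> 2 * x1 - (x2 + 1)"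
      unfolding m_threshold_def x1_def[symmetric] x2_def[symmetric] by linarith
    ultimately have "real_of_int (m_threshold N d \<epsilon>) \<ge> (1 + 5 * \<eta>) * T - 1" using \<open>x2 \<le> x1\<close> by linarith
    moreover have "(1 + 5 * \<eta>) * T - 1 \<ge> (1 + 4 * \<eta>) * T" using T by (simp add: algebra_simps)
    ultimately have "real_of_int (int (k + b)) \<le> real_of_int (m_threshold N d \<epsilon>)" using m1 by simp
    then show ?thesis by (simp only: of_int_le_iff)
  qed
  \<comment> \<open>Absorption gives \<open>d * (j choose d) = j * (i choose e)\<close>, and
    \<open>d \<ge> 2\<close> gains the factor 1/2 that allows \<open>\<theta>\<close> to be below
    1.\<close>
  have dom: "2 ^ (j choose d) \<le> R ^ j" if j: "j \<le> k + b" for j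
  proof (cases j)
    case 0
    then show ?thesis using e by simp
  next
    case (Suc i)
    have "real (i choose e) * F \<le> real (k + b) ^ e"
    proof -
      have "(i choose e) * fact e \<le> i ^ e" by (rule binomial_fact_pow)
      also have "\<dots> \<le> (k + b) ^ e" using j Suc by (intro power_mono) auto
      finally have "real ((i choose e) * fact e) \<le> real ((k + b) ^ e)" using of_nat_le_iff by blast
      then show ?thesis by (simp add: F)
    qed
    also have "\<dots> \<le> ((1 + 5 * \<eta>) * T) ^ e"
      using m1 mult_pos_pos[OF \<eta>(1) Tpos] by (intro power_mono) (simp_all add: algebra_simps)
    also have "\<dots> = (1 + 5 * \<eta>) ^ e * (F * L)" by (simp add: power_mult_distrib Te)
    also have "\<dots> \<le> 2 * \<theta> * (F * L)" using h\<theta> e FL by (intro mult_right_mono) auto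
    finally have "F * real (i choose e) \<le> F * (2 * \<theta> * L)" by (simp add: mult_ac)
    then have ie: "real (i choose e) \<le> 2 * \<theta> * L" using F by simp
    have "2 * real (j choose d) \<le> real d * real (j choose d)" using d by (intro mult_right_mono) auto
    also have "\<dots> = real (Suc e * (Suc i choose Suc e))" by (simp only: Suc e of_nat_mult)
    also have "\<dots> = real j * real (i choose e)" unfolding binomial_absorption by (simp add: Suc algebra_simps)
    also have "\<dots> \<le> real j * (2 * \<theta> * L)" using ie by (intro mult_left_mono) auto
    finally have "real (j choose d) \<le> real j * \<theta> * L" by simp
    then have "2 powr real (j choose d) \<le> 2 powr (real j * \<theta> * L)" by simp
    also have "\<dots> = R powr real j" by (simp add: R_def N2 powr_powr mult_ac)
    finally show ?thesis using N by (simp add: powr_realpow R_def)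
  qed
  have kle: "k \<le> N" using k5 kN by linarith
  have \<kappa>le: "\<kappa> \<le> N" "real \<kappa> \<le> real N powr \<beta>"
  proof -
    show *: "real \<kappa> \<le> real N powr \<beta>" unfolding \<kappa>_def by (simp add: of_nat_nat)
    have "real N powr \<beta> \<le> real N powr 1" using \<beta> N by (intro powr_mono) auto
    then show "\<kappa> \<le> N" using * N by simp
  qed
  have Ypos: "0 < Y" using Y by linarith
  have R0: "0 \<le> R" by (simp add: R_def)
  define good where "good = {E. kcliques N d E k \<noteq> {} \<and>
      real (card (clique_pairs N d E k b)) \<le> 2 * (1 / Y) * real (card (kcliques N d E k))}"
  have "good \<subseteq> ?slow"
  proof clarify
    fix E and lam :: real assume E: "E \<in> good" and lam: "1 < lam"
    \<comment> \<open>With gateway proportion \<open>q = 2 / Y\<close>, the time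
      \<open>Y / 8\<close> meets the requirement \<open>t * q \<le> 1/4\<close>.\<close>
    define t where "t = nat \<lfloor>Y / 8\<rfloor>"
    have t: "real t \<le> Y / 8" "Y / 8 - 1 \<le> real t" using Ypos unfolding t_def by (auto simp: of_nat_nat) linarith
    have "real N powr (\<eta>\<^sup>2 / 16 * L powr p) < real t / 2"
    proof -
      \<comment> \<open>The claimed time is \<open>sqrt Y\<close>; \<open>400 = 20 * 20\<close>
        makes \<open>Y / 16\<close> exceed it despite the rounding of \<open>t\<close>.\<close>
      define s where "s = real N powr (\<eta>\<^sup>2 / 16 * L powr p)"
      have s2: "s * s = Y" unfolding s_def Y_def by (simp add: mult.commute flip: powr_add)
      have s0: "0 \<le> s" by (simp add: s_def)
      have s20: "20 \<le> s"
      proof (rule ccontr)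
        assume "\<not> 20 \<le> s"
        then have "s * s < 20 * 20" using s0 by (intro mult_strict_mono) auto
        then show False using s2 Y by simp
      qed
      then have "20 * s \<le> Y" using s2 mult_right_mono[of 20 s s] by simp
      then show ?thesis using t s20 unfolding s_def[symmetric] by linarith
    qed
    moreover have "\<exists>K0. is_clique N d E K0 \<and> ennreal (real t / 2) \<le> metro_expected_hit N d E lam (m_threshold N d \<epsilon>) K0"
    proof (rule slow_initial_state[where q = "2 * (1 / Y)", OF lam _ m_le])
      show "real t * (2 * (1 / Y)) \<le> 1 / 4" "2 * (1 / Y) \<le> 1/2" using t Y Ypos by (auto simp: field_simps)
      show "1 \<le> k" using e by (simp add: k_def a_def)
    qed (use E N in \<open>auto simp: good_def k_def\<close>)
    ultimately show "\<exists>K0. is_clique N d E K0 \<and> ennreal (real N powr (\<eta>\<^sup>2 / 16 * L powr p))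
        < metro_expected_hit N d E lam (m_threshold N d \<epsilon>) K0"
      by (meson ennreal_lessI less_le_trans powr_ge_zero order_le_less_trans)
  qed
  then have "measure_pmf.prob ?P good \<le> measure_pmf.prob ?P ?slow"
    by (intro measure_pmf.finite_measure_mono) auto
  moreover have "measure_pmf.prob ?P good \<ge> 1 - 4 * ((1 + real k * R / real N) ^ k - 1)
        - 2 ^ k * real N ^ b * (2 ^ ((k - b) choose d) / 2 ^ (k choose d)) * (1 + real \<kappa> * R / real N) ^ (k + b) / (1 / Y)"
    unfolding good_def \<kappa>_def[symmetric]
    by (rule prob_many_cliques_few_pairs[OF _ \<kappa>le(1) kle _ R0 _ dom]) (use N Ypos in \<open>auto simp: k_def\<close>)
  moreover have "(1 + real k * R / real N) ^ k \<le> exp ((5 * F * L)\<^sup>2 * real N powr \<theta> / real N)"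
  proof -
    have "(1 + real k * R / real N) ^ k \<le> exp (real k * R / real N) ^ k"
      using R0 by (intro power_mono exp_ge_add_one_self) auto
    also have "\<dots> = exp ((real k)\<^sup>2 * (R / real N))" by (simp add: power2_eq_square flip: exp_of_nat_mult)
    also have "\<dots> \<le> exp ((5 * F * L)\<^sup>2 * (R / real N))"
      using k5 R0 by (intro exp_le_cancel_iff[THEN iffD2] mult_right_mono power_mono) auto
    finally show ?thesis by (simp add: R_def)
  qed
  moreover have "2 ^ k * real N ^ b * (2 ^ ((k - b) choose d) / 2 ^ (k choose d)) * (1 + real \<kappa> * R / real N) ^ (k + b) / (1 / Y) \<le> 2 / Y"
  proof -
    \<comment> \<open>By \<open>h\<kappa>\<close>, the planted clique at most doubles the bound on
      the number of pairs.\<close>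
    have planted: "(1 + real \<kappa> * R / real N) ^ (k + b) \<le> 2"
    proof -
      have "(1 + real \<kappa> * R / real N) ^ (k + b) \<le> exp (real \<kappa> * R / real N) ^ (k + b)"
        using R0 by (intro power_mono exp_ge_add_one_self) auto
      also have "\<dots> = exp (real (k + b) * (real \<kappa> * (R / real N)))"
        by (subst exp_of_nat_mult[symmetric]) simp
      also have "\<dots> \<le> exp ((5 * F * L) * (real N powr \<beta> * (R / real N)))"
        using m6 \<kappa>le R0 F L1 by (intro exp_le_cancel_iff[THEN iffD2] mult_mono mult_right_mono mult_nonneg_nonneg) auto
      also have "\<dots> \<le> exp (1/2)" using h\<kappa> by (simp add: R_def mult.assoc)
      also have "\<dots> \<le> 2" using exp_bound[of "1/2"] by (simp add: power2_eq_square)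
      finally show ?thesis .
    qed
    have "(1 + \<eta>) * L \<le> real (a choose e)"
    proof -
      \<comment> \<open>The summand \<open>d\<close> in \<open>a\<close> pays for the loss of
        \<open>e\<close> in the falling factorial bound.\<close>
      have "(1 + \<eta>) * T \<le> real (a - e)" using a1 e by (simp add: of_nat_diff)
      then have "((1 + \<eta>) * T) ^ e \<le> real (a - e) ^ e" using \<eta>1 by (intro power_mono)
      also have "\<dots> = real ((a - e) ^ e)" by simp
      also have "\<dots> \<le> real ((a choose e) * fact e)" using power_le_binomial_fact of_nat_le_iff by blast
      finally have "(1 + \<eta>) ^ e * (F * L) \<le> real (a choose e) * F" by (simp add: power_mult_distrib Te F)
      moreover have "(1 + \<eta>) ^ 1 * (F * L) \<le> (1 + \<eta>) ^ e * (F * L)"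
        using \<eta> e FL by (intro mult_right_mono power_increasing) auto
      ultimately have "F * ((1 + \<eta>) * L) \<le> F * real (a choose e)" by (simp add: mult_ac)
      then show ?thesis using F by simp
    qed
    then have "real b * ((1 + \<eta>) * L) \<le> real b * real (a choose e)" by (intro mult_left_mono) auto
    moreover have "real ((a choose d) + b * (a choose e)) \<le> real (k choose d)"
      using binomial_add_lower[of a e b] unfolding k_def e of_nat_le_iff .
    ultimately have ch: "real (a choose d) + real b * ((1 + \<eta>) * L) \<le> real (k choose d)" by simp
    \<comment> \<open>The surplus \<open>\<eta> * real b * L\<close> is at least
      \<open>\<eta>\<^sup>2 * T * L / 2\<close>. Half of that pays for the factor
      \<open>2 ^ k\<close>, which needs \<open>20 / \<eta>\<^sup>2 \<le> L\<close>; the other half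
      yields \<open>1 / (Y * Y)\<close>.\<close>
    have "5 * T \<le> \<eta> * (\<eta> * T / 2) * L / 2"
    proof -
      have "20 \<le> \<eta>\<^sup>2 * L" using L \<eta> by (simp add: field_simps)
      then have "20 * T \<le> \<eta>\<^sup>2 * L * T" using Tpos by (intro mult_right_mono) auto
      then show ?thesis by (simp add: power2_eq_square field_simps)
    qed
    moreover have "\<eta> * (\<eta> * T / 2) * L \<le> \<eta> * real b * L"
      using b2 \<eta> L1 by (intro mult_right_mono mult_left_mono) auto
    moreover have "\<eta>\<^sup>2 / 8 * L powr p * L \<le> \<eta>\<^sup>2 / 8 * T * L"
      using LT L1 by (intro mult_right_mono mult_left_mono) auto
    moreover have "\<eta>\<^sup>2 / 8 * T * L = (\<eta> * (\<eta> * T / 2) * L / 2) / 2" by (simp add: power2_eq_square)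
    moreover have "real b * ((1 + \<eta>) * L) = L * real b + \<eta> * real b * L" by (simp add: algebra_simps)
    ultimately have ex: "real k + L * real b + real (a choose d) - real (k choose d) \<le> - 2 * (\<eta>\<^sup>2 / 8 * L powr p * L)"
      using k5(1) ch by linarith
    have "2 ^ k * real N ^ b * (2 ^ (a choose d) / 2 ^ (k choose d))
        = 2 powr (real k + L * real b + real (a choose d) - real (k choose d))"
      by (simp add: N2 powr_add powr_diff powr_realpow powr_power mult.commute)
    also have "\<dots> \<le> 2 powr (- 2 * (\<eta>\<^sup>2 / 8 * L powr p * L))" using ex by simp
    also have "\<dots> = 1 / (Y * Y)"
    proof -
      have Yz: "Y = 2 powr (\<eta>\<^sup>2 / 8 * L powr p * L)"
        unfolding Y_def N2 powr_powr by (simp only: mult_ac)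
      have "2 powr (- 2 * (\<eta>\<^sup>2 / 8 * L powr p * L)) * (Y * Y) = 1"
        unfolding Yz powr_add[symmetric] by simp
      then show ?thesis using Ypos by (simp add: eq_divide_eq)
    qed
    finally have A: "2 ^ k * real N ^ b * (2 ^ (a choose d) / 2 ^ (k choose d)) \<le> 1 / (Y * Y)" .
    have "2 ^ k * real N ^ b * (2 ^ ((k - b) choose d) / 2 ^ (k choose d)) * (1 + real \<kappa> * R / real N) ^ (k + b)
        \<le> 1 / (Y * Y) * 2"
      using A planted R0 Ypos by (intro mult_mono) (auto simp: k_def)
    then have "2 ^ k * real N ^ b * (2 ^ ((k - b) choose d) / 2 ^ (k choose d)) * (1 + real \<kappa> * R / real N) ^ (k + b) / (1 / Y)
        \<le> 1 / (Y * Y) * 2 / (1 / Y)"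
      using Ypos by (intro divide_right_mono) auto
    then show ?thesis using Ypos by simp
  qed
  moreover have "1 - 4 * (X - 1) - Z \<le> P2"
    if "P1 \<le> P2" "1 - 4 * (x - 1) - z \<le> P1" "x \<le> X" "z \<le> Z" for P1 P2 x X z Z :: real
    using that by (simp add: algebra_simps)
  ultimately show ?thesis by blast
qed

theorem mainTheorem11:
  fixes d :: nat and \<epsilon> \<beta> :: real
  assumes "d \<ge> 2" and "\<epsilon> > 0" and "0 < \<beta>" and "\<beta> < 1/2"
  shows "\<exists>c>0. (\<lambda>N. measure_pmf.prob (planted_hypergraph N d (nat \<lfloor>real N powr \<beta>\<rfloor>))
            {E. \<forall>lam>1. \<exists>K0. is_clique N d E K0 \<and>
                 ennreal (real N powr (c * (log 2 (real N)) powr (1 / (real d - 1))))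
                   < metro_expected_hit N d E lam (m_threshold N d \<epsilon>) K0})
         \<longlonglongrightarrow> 1"
proof -
  \<comment> \<open>The midpoint of \<open>1/2\<close> and \<open>1 - \<beta>\<close>, an interval
    that is nonempty because \<open>\<beta> < 1/2\<close>.\<close>
  define \<theta> where "\<theta> = (3/2 - \<beta>) / 2"
  have \<theta>: "1/2 < \<theta>" "\<theta> < 1" "\<beta> + \<theta> < 1" using assms by (simp_all add: \<theta>_def field_simps)
  \<comment> \<open>The limit is 1, strictly below both \<open>2 * \<theta>\<close> and
    \<open>1 + 2/3 * \<epsilon>\<close>, so a small positive \<open>\<eta>\<close> meets both
    constraints.\<close>
  have "((\<lambda>\<eta>::real. (1 + 5 * \<eta>) ^ (d - 1)) \<longlongrightarrow> (1 + 5 * 0) ^ (d - 1)) (at_right 0)"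
    by (intro tendsto_intros)
  then have "\<forall>\<^sub>F \<eta>::real in at_right 0. (1 + 5 * \<eta>) ^ (d - 1) < min (2 * \<theta>) (1 + 2/3 * \<epsilon>)"
    using \<theta> assms by (intro order_tendstoD(2)[of _ 1]) auto
  moreover have "\<forall>\<^sub>F \<eta>::real in at_right 0. 0 < \<eta> \<and> \<eta> < 1"
    by (auto simp: eventually_at_right_field intro: exI[of _ 1])
  ultimately have "\<forall>\<^sub>F \<eta>::real in at_right 0. (1 + 5 * \<eta>) ^ (d - 1) < min (2 * \<theta>) (1 + 2/3 * \<epsilon>) \<and> 0 < \<eta> \<and> \<eta> < 1"
    by eventually_elim auto
  then obtain \<eta> :: real where \<eta>: "(1 + 5 * \<eta>) ^ (d - 1) < min (2 * \<theta>) (1 + 2/3 * \<epsilon>)" "0 < \<eta>" "\<eta> < 1"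
    using eventually_happens[of _ "at_right (0::real)"] by auto
  define p where "p = 1 / (real d - 1)"
  define F :: real where "F = fact (d - 1)"
  define L where "L = (\<lambda>N::nat. log 2 (real N))"
  define Y where "Y = (\<lambda>N::nat. real N powr (\<eta>\<^sup>2 / 8 * L N powr p))"
  define slow where "slow = (\<lambda>N. {E. \<forall>lam>1. \<exists>K0. is_clique N d E K0 \<and>
                 ennreal (real N powr (\<eta>\<^sup>2 / 16 * L N powr p))
                   < metro_expected_hit N d E lam (m_threshold N d \<epsilon>) K0})"
  define P where "P = (\<lambda>N. measure_pmf.prob (planted_hypergraph N d (nat \<lfloor>real N powr \<beta>\<rfloor>)) (slow N))"
  define low where "low = (\<lambda>N. 1 - 4 * (exp ((5 * F * L N)\<^sup>2 * real N powr \<theta> / real N) - 1) - 2 / Y N)"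
  have p: "0 < p" and F: "0 < F" using assms by (auto simp: p_def F_def)
  have L_top: "filterlim L at_top sequentially" unfolding L_def by real_asymp
  have T_top: "filterlim (\<lambda>N. (F * L N) powr p) at_top sequentially"
    unfolding L_def using p F by real_asymp
  have Y_top: "filterlim Y at_top sequentially"
    unfolding Y_def L_def using p \<eta>(2) by real_asymp
  \<comment> \<open>\<open>s1\<close> makes the relative variance vanish and uses
    \<open>\<theta> < 1\<close>; \<open>s2\<close> controls the planted clique and uses
    \<open>\<beta> + \<theta> < 1\<close>.\<close>
  have s1: "(\<lambda>N. (5 * F * L N)\<^sup>2 * real N powr \<theta> / real N) \<longlonglongrightarrow> 0"
    unfolding L_def using \<theta> F by real_asymp
  have s2: "(\<lambda>N. 5 * F * L N * real N powr \<beta> * real N powr \<theta> / real N) \<longlonglongrightarrow> 0"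
    unfolding L_def using \<theta> F by real_asymp
  have s3: "\<forall>\<^sub>F N in sequentially. 5 * F * L N \<le> real N"
    unfolding L_def using F by real_asymp
  have "(\<lambda>N. exp ((5 * F * L N)\<^sup>2 * real N powr \<theta> / real N)) \<longlonglongrightarrow> exp 0" by (intro tendsto_exp s1)
  moreover have "(\<lambda>N. 2 / Y N) \<longlonglongrightarrow> 0"
    by (intro tendsto_divide_0[OF tendsto_const] filterlim_at_top_imp_at_infinity Y_top)
  ultimately have "low \<longlonglongrightarrow> 1 - 4 * (exp 0 - 1) - 0"
    unfolding low_def by (intro tendsto_diff tendsto_mult tendsto_const)
  then have low1: "low \<longlonglongrightarrow> 1" by simp
  have "\<forall>\<^sub>F N in sequentially. (real d + 2) / \<eta> \<le> (F * L N) powr p"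
    using T_top by (simp add: filterlim_at_top)
  moreover have "\<forall>\<^sub>F N in sequentially. 20 / \<eta>\<^sup>2 \<le> L N" using L_top by (simp add: filterlim_at_top)
  moreover have "\<forall>\<^sub>F N in sequentially. 400 \<le> Y N" using Y_top by (simp add: filterlim_at_top)
  moreover have "\<forall>\<^sub>F N in sequentially. 5 * F * L N * real N powr \<beta> * real N powr \<theta> / real N < 1/2"
    using s2 by (rule order_tendstoD) simp
  ultimately have "\<forall>\<^sub>F N in sequentially. low N \<le> P N"
    using s3 eventually_ge_at_top[of 2]
  proof eventually_elim
    case (elim N)
    have T: "real d + 2 \<le> \<eta> * (F * L N) powr p" using elim(1) \<eta> by (simp add: field_simps)
    show ?case
      unfolding low_def P_def slow_def L_def p_def F_def Y_def
      by (rule prob_slow_ge)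
        (use assms \<eta> elim T in \<open>auto simp: L_def p_def F_def Y_def\<close>)
  qed
  moreover have "\<forall>\<^sub>F N in sequentially. P N \<le> 1" by (simp add: P_def)
  ultimately have "P \<longlonglongrightarrow> 1"
    by (rule tendsto_sandwich[OF _ _ low1 tendsto_const])
  then show ?thesis
    using \<eta> by (intro exI[of _ "\<eta>\<^sup>2 / 16"]) (auto simp: P_def slow_def L_def p_def)
qed

end
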